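(* Let $(X,\omega_X)$ be a network and let $k\ge 0$ be an integer. Then $$\mathrm{Dgm}_k^{\mathrm{si}}(X)=\mathrm{Dgm}_k^{\mathrm{so}}(X).$$
   Context: A network is a pair $(X,\omega_X)$ where $X$ is a finite (nonempty) set and $\omega_X:X\times X\to\mathbb R$ is any function. For $\delta\in\mathbb R$, the Dowker $\delta$-sink complex $\mathfrak D^{\mathrm{si}}_{\delta,X}$ consists of all nonempty $\sigma\subseteq X$ for which there is $x'\in X$ with $\omega_X(x,x')\le\delta$ for all $x\in\sigma$; the Dowker $\delta$-source complex $\mathfrak D^{\mathrm{so}}_{\delta,X}$ consists of all nonempty $\sigma\subseteq X$ for which there is $x'\in X$ with $\omega_X(x',x)\le\delta$ for all $x\in\sigma$. Each family is a filtration under inclusion as $\delta$ increases. Fix a field $\mathbb K$. $\mathrm{Dgm}_k^{\mathrm{si}}(X)$ (resp. $\mathrm{Dgm}_k^{\mathrm{so}}(X)$) is the persistence diagram of the persistence vector space obtained by applying $H_k(\cdot;\mathbb K)$ to the sink (resp. source) filtration, i.e. the multiset of points $(a,b)\in\overline{\mathbb R}^2$ ($\overline{\mathbb R}=\mathbb R\cup\{\pm\infty\}$), one for each interval $[a,b)$ in its decomposition into interval modules. *)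

theory Defs
  imports "Jordan_Normal_Form.VS_Connect" "HOL-Algebra.AbelCoset" "HOL-Library.Extended_Real"
begin

section \<open>Simplicial homology with field coefficients\<close>

definition simplicial_complex :: "'a set set \<Rightarrow> bool" where
  "simplicial_complex K \<longleftrightarrow>
     (\<forall>\<sigma>\<in>K. finite \<sigma> \<and> \<sigma> \<noteq> {} \<and> (\<forall>\<tau>\<subseteq>\<sigma>. \<tau> \<noteq> {} \<longrightarrow> \<tau> \<in> K))"

text \<open>
  An auxiliary total order on all potential vertices, the same for all complexes; it exists by the
  well-ordering theorem. Every simplex is oriented by listing its vertices increasingly.
\<close>

definition vertex_order :: "'a rel" where
  "vertex_order = (SOME r. linear_order r)"

text \<open>
  If the vertices of \<open>\<sigma>\<close> are \<open>v\<^sub>0 < \<dots> < v\<^sub>n\<close>, then \<open>face_sign \<sigma> v\<^sub>i = (- 1) ^ i\<close>.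
\<close>

definition face_sign :: "'a set \<Rightarrow> 'a \<Rightarrow> 'k::field" where
  "face_sign \<sigma> v = (- 1) ^ card {u \<in> \<sigma>. u \<noteq> v \<and> (u, v) \<in> vertex_order}"

text \<open>
  A chain is a finitely supported function on simplices, \<open>c\<close> standing for the formal linear
  combination \<open>\<Sum>\<sigma>. c \<sigma> \<cdot> [\<sigma>]\<close>.
\<close>

definition simplicial_chains :: "nat \<Rightarrow> 'a set set \<Rightarrow> ('a set \<Rightarrow> 'k::field) set" where
  "simplicial_chains k K = {c. finite {\<sigma>. c \<sigma> \<noteq> 0} \<and> {\<sigma>. c \<sigma> \<noteq> 0} \<subseteq> {\<sigma> \<in> K. card \<sigma> = k + 1}}"

text \<open>
  The linear extension of \<open>\<partial>[v\<^sub>0, \<dots>, v\<^sub>n] = (\<Sum>i\<le>n. (- 1) ^ i \<cdot> [v\<^sub>0, \<dots>, v\<^sub>i\<^sub>-\<^sub>1, v\<^sub>i\<^sub>+\<^sub>1, \<dots>, v\<^sub>n])\<close>. The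
  clause for the empty face makes \<open>\<partial>\<close> vanish on 0-chains, so that homology is unreduced.
\<close>

definition boundary :: "('a set \<Rightarrow> 'k::field) \<Rightarrow> 'a set \<Rightarrow> 'k" where
  "boundary c \<tau> = (if \<tau> = {} then 0
     else \<Sum>\<sigma> | c \<sigma> \<noteq> 0. c \<sigma> * (\<Sum>v | v \<in> \<sigma> \<and> \<sigma> - {v} = \<tau>. face_sign \<sigma> v))"

definition cycles :: "nat \<Rightarrow> 'a set set \<Rightarrow> ('a set \<Rightarrow> 'k::field) set" where
  "cycles k K = {c \<in> simplicial_chains k K. boundary c = (\<lambda>_. 0)}"

definition boundaries :: "nat \<Rightarrow> 'a set set \<Rightarrow> ('a set \<Rightarrow> 'k::field) set" where
  "boundaries k K = boundary ` simplicial_chains (k + 1) K"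

text \<open>
  The library represents vector spaces by ring records with a scalar multiplication; the fields
  \<open>mult\<close> and \<open>one\<close> play no role for vector spaces and are filled arbitrarily here and below.
\<close>

definition cycle_space :: "nat \<Rightarrow> 'a set set \<Rightarrow> ('k::field, 'a set \<Rightarrow> 'k) module" where
  "cycle_space k K = \<lparr>carrier = cycles k K, mult = (\<lambda>c d \<sigma>. 0), one = (\<lambda>\<sigma>. 0),
     zero = (\<lambda>\<sigma>. 0), add = (\<lambda>c d \<sigma>. c \<sigma> + d \<sigma>), smult = (\<lambda>a c \<sigma>. a * c \<sigma>)\<rparr>"

definition quotient_space :: "('k, 'v) module \<Rightarrow> 'v set \<Rightarrow> ('k, 'v set) module" where
  "quotient_space V W = \<lparr>carrier = a_rcosets\<^bsub>V\<^esub> W, mult = (\<lambda>C D. W), one = W,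
     zero = W, add = set_add V, smult = (\<lambda>a C. \<Union>x\<in>C. W +>\<^bsub>V\<^esub> (a \<odot>\<^bsub>V\<^esub> x))\<rparr>"

definition homology :: "nat \<Rightarrow> 'a set set \<Rightarrow> ('k::field, ('a set \<Rightarrow> 'k) set) module" where
  "homology k K = quotient_space (cycle_space k K) (boundaries k K)"

text \<open>
  The map induced on homology by the inclusion of a subcomplex into \<open>L\<close>: the class of \<open>z\<close> in the
  subcomplex is sent to the class of \<open>z\<close> in \<open>L\<close>. (All representatives \<open>z \<in> C\<close> give the same class
  in \<open>L\<close>.)
\<close>

definition homology_inclusion ::
  "nat \<Rightarrow> 'a set set \<Rightarrow> ('a set \<Rightarrow> 'k::field) set \<Rightarrow> ('a set \<Rightarrow> 'k) set" where
  "homology_inclusion k L C = (\<Union>z\<in>C. boundaries k L +>\<^bsub>cycle_space k L\<^esub> z)"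


section \<open>Persistence vector spaces and their diagrams\<close>

record ('k, 'v) persistence =
  space_at :: "real \<Rightarrow> ('k, 'v) module"
  map_at :: "real \<Rightarrow> real \<Rightarrow> 'v \<Rightarrow> 'v"

locale persistence_vector_space =
  fixes V :: "('k::field, 'v) persistence"
  assumes linear: "s \<le> t \<Longrightarrow> linear_map class_ring (space_at V s) (space_at V t) (map_at V s t)"
    and map_id: "x \<in> carrier (space_at V t) \<Longrightarrow> map_at V t t x = x"
    and map_comp: "\<lbrakk>r \<le> s; s \<le> t; x \<in> carrier (space_at V r)\<rbrakk> \<Longrightarrow>
      map_at V s t (map_at V r s x) = map_at V r t x"

definition persistence_isomorphic ::
  "('k::field, 'v) persistence \<Rightarrow> ('k, 'w) persistence \<Rightarrow> bool" where
  "persistence_isomorphic V W \<longleftrightarrow> (\<exists>\<phi>.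
     (\<forall>t. linear_map class_ring (space_at V t) (space_at W t) (\<phi> t) \<and>
          bij_betw (\<phi> t) (carrier (space_at V t)) (carrier (space_at W t))) \<and>
     (\<forall>s t. s \<le> t \<longrightarrow> (\<forall>x\<in>carrier (space_at V s).
          \<phi> t (map_at V s t x) = map_at W s t (\<phi> s x))))"

definition interval :: "ereal \<times> ereal \<Rightarrow> real set" where
  "interval p = {t. fst p \<le> ereal t \<and> ereal t < snd p}"

definition interval_module :: "ereal \<times> ereal \<Rightarrow> ('k::field, 'k) persistence" where
  "interval_module p = \<lparr>
     space_at = (\<lambda>t. \<lparr>carrier = (if t \<in> interval p then UNIV else {0}),
       mult = (*), one = 0, zero = 0, add = (+), smult = (*)\<rparr>),
     map_at = (\<lambda>s t x. if s \<in> interval p \<and> t \<in> interval p then x else 0)\<rparr>"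

definition persistence_direct_sum ::
  "('k, 'v) persistence list \<Rightarrow> ('k, nat \<Rightarrow> 'v) persistence" where
  "persistence_direct_sum Vs = \<lparr>
     space_at = (\<lambda>t. \<lparr>carrier = (\<Pi>\<^sub>E i\<in>{..<length Vs}. carrier (space_at (Vs ! i) t)),
       mult = (\<lambda>f g. \<lambda>i\<in>{..<length Vs}. \<zero>\<^bsub>space_at (Vs ! i) t\<^esub>),
       one = (\<lambda>i\<in>{..<length Vs}. \<zero>\<^bsub>space_at (Vs ! i) t\<^esub>),
       zero = (\<lambda>i\<in>{..<length Vs}. \<zero>\<^bsub>space_at (Vs ! i) t\<^esub>),
       add = (\<lambda>f g. \<lambda>i\<in>{..<length Vs}. f i \<oplus>\<^bsub>space_at (Vs ! i) t\<^esub> g i),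
       smult = (\<lambda>a f. \<lambda>i\<in>{..<length Vs}. a \<odot>\<^bsub>space_at (Vs ! i) t\<^esub> f i)\<rparr>),
     map_at = (\<lambda>s t f. \<lambda>i\<in>{..<length Vs}. map_at (Vs ! i) s t (f i))\<rparr>"

text \<open>
  \<open>D\<close> lists, with multiplicity, the end points of the intervals in a decomposition of \<open>V\<close> into
  (finitely many) interval modules. The condition \<open>a < b\<close> says that the intervals are nonempty.
\<close>

definition interval_decomposition ::
  "('k::field, 'v) persistence \<Rightarrow> (ereal \<times> ereal) multiset \<Rightarrow> bool" where
  "interval_decomposition V D \<longleftrightarrow> (\<exists>ps. mset ps = D \<and> (\<forall>(a, b)\<in>set ps. a < b) \<and>
     persistence_isomorphic V (persistence_direct_sum (map interval_module ps)))"

definition persistence_diagram ::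
  "('k::field, 'v) persistence \<Rightarrow> (ereal \<times> ereal) multiset" where
  "persistence_diagram V = (THE D. interval_decomposition V D)"

definition persistent_homology ::
  "nat \<Rightarrow> (real \<Rightarrow> 'a set set) \<Rightarrow> ('k::field, ('a set \<Rightarrow> 'k) set) persistence" where
  "persistent_homology k F = \<lparr>space_at = (\<lambda>t. homology k (F t)),
     map_at = (\<lambda>s t. homology_inclusion k (F t))\<rparr>"


section \<open>Dowker filtrations of a network\<close>

definition dowker_sink :: "'a set \<Rightarrow> ('a \<Rightarrow> 'a \<Rightarrow> real) \<Rightarrow> real \<Rightarrow> 'a set set" where
  "dowker_sink X \<omega> \<delta> = {\<sigma>. \<sigma> \<noteq> {} \<and> \<sigma> \<subseteq> X \<and> (\<exists>x'\<in>X. \<forall>x\<in>\<sigma>. \<omega> x x' \<le> \<delta>)}"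

definition dowker_source :: "'a set \<Rightarrow> ('a \<Rightarrow> 'a \<Rightarrow> real) \<Rightarrow> real \<Rightarrow> 'a set set" where
  "dowker_source X \<omega> \<delta> = {\<sigma>. \<sigma> \<noteq> {} \<and> \<sigma> \<subseteq> X \<and> (\<exists>x'\<in>X. \<forall>x\<in>\<sigma>. \<omega> x' x \<le> \<delta>)}"

text \<open>The coefficient field is passed as a type argument.\<close>

definition Dgm_sink ::
  "'k::field itself \<Rightarrow> nat \<Rightarrow> 'a set \<Rightarrow> ('a \<Rightarrow> 'a \<Rightarrow> real) \<Rightarrow> (ereal \<times> ereal) multiset" where
  "Dgm_sink _ k X \<omega> = persistence_diagram
     (persistent_homology k (dowker_sink X \<omega>) :: ('k, ('a set \<Rightarrow> 'k) set) persistence)"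

definition Dgm_source ::
  "'k::field itself \<Rightarrow> nat \<Rightarrow> 'a set \<Rightarrow> ('a \<Rightarrow> 'a \<Rightarrow> real) \<Rightarrow> (ereal \<times> ereal) multiset" where
  "Dgm_source _ k X \<omega> = persistence_diagram
     (persistent_homology k (dowker_source X \<omega>) :: ('k, ('a set \<Rightarrow> 'k) set) persistence)"


section \<open>The constructions above yield persistence vector spaces\<close>

definition incidence :: "'a set \<Rightarrow> 'a set \<Rightarrow> 'k::field" where
  "incidence \<sigma> \<tau> = (\<Sum>v | v \<in> \<sigma> \<and> \<sigma> - {v} = \<tau>. face_sign \<sigma> v)"

lemma boundary_eq:
  assumes "finite S" "{\<sigma>. c \<sigma> \<noteq> 0} \<subseteq> S"
  shows "boundary c \<tau> = (if \<tau> = {} then 0 else \<Sum>\<sigma>\<in>S. c \<sigma> * incidence \<sigma> \<tau>)"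
proof -
  have "(\<Sum>\<sigma> | c \<sigma> \<noteq> 0. c \<sigma> * incidence \<sigma> \<tau>) = (\<Sum>\<sigma>\<in>S. c \<sigma> * incidence \<sigma> \<tau>)"
    by (rule sum.mono_neutral_left) (use assms in auto)
  then show ?thesis by (simp add: boundary_def incidence_def)
qed

lemma linear_vertex_order: "linear_order (vertex_order :: 'a rel)"
proof -
  obtain r :: "'a rel" where "well_order r" using well_order_on by blast
  then have "linear_order r" by (simp add: well_order_on_def)
  then show ?thesis unfolding vertex_order_def by (rule someI)
qed

abbreviation vertex_less :: "'a \<Rightarrow> 'a \<Rightarrow> bool" where "vertex_less u v \<equiv> u \<noteq> v \<and> (u, v) \<in> vertex_order"

lemma vertex_less_linear:
  fixes u v :: 'a
  assumes "u \<noteq> v"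
  shows "vertex_less u v \<or> vertex_less v u"
proof -
  have "total (vertex_order :: 'a rel)"
    using linear_vertex_order unfolding linear_order_on_def by (rule conjunct2)
  with assms show ?thesis unfolding total_on_def by blast
qed

lemma vertex_less_asym:
  fixes u v :: 'a
  assumes "vertex_less u v"
  shows "\<not> vertex_less v u"
proof -
  have "antisym (vertex_order :: 'a rel)"
    using linear_vertex_order unfolding linear_order_on_def partial_order_on_def by blast
  with assms show ?thesis by (blast dest: antisymD)
qed

lemma face_sign_swap:
  fixes v w :: 'a
  assumes "finite \<sigma>" "v \<in> \<sigma>" "w \<in> \<sigma>" "vertex_less v w"
  shows "face_sign \<sigma> w * face_sign (\<sigma> - {w}) v = - (face_sign \<sigma> v * face_sign (\<sigma> - {v}) w :: 'k::field)"
proof -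
  have 1: "{u \<in> \<sigma> - {w}. vertex_less u v} = {u \<in> \<sigma>. vertex_less u v}" using vertex_less_asym[OF assms(4)] by auto
  have 2: "{u \<in> \<sigma>. vertex_less u w} = insert v {u \<in> \<sigma> - {v}. vertex_less u w}" using assms by auto
  have "card {u \<in> \<sigma>. vertex_less u w} = Suc (card {u \<in> \<sigma> - {v}. vertex_less u w})"
    unfolding 2 using assms(1) by simp
  then show ?thesis unfolding face_sign_def 1 by simp
qed

lemma incidence_incidence:
  assumes fin: "finite \<sigma>" and T: "finite T" "\<And>v. v \<in> \<sigma> \<Longrightarrow> \<sigma> - {v} \<noteq> {} \<Longrightarrow> \<sigma> - {v} \<in> T" and ne: "{} \<notin> T"
  shows "(\<Sum>\<tau>\<in>T. incidence \<sigma> \<tau> * incidence \<tau> \<rho>) = (0::'k::field)"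
proof -
  define A where "A = {(v, w). v \<in> \<sigma> \<and> w \<in> \<sigma> \<and> v \<noteq> w \<and> \<sigma> - {v} - {w} = \<rho>}"
  define g where "g = (\<lambda>(v, w). face_sign \<sigma> v * face_sign (\<sigma> - {v}) w :: 'k)"
  define T' where "T' = insert {} T"
  have T': "finite T'" "\<And>v. v \<in> \<sigma> \<Longrightarrow> \<sigma> - {v} \<in> T'" using T by (auto simp: T'_def)
  have finA: "finite A" by (rule finite_subset[of _ "\<sigma> \<times> \<sigma>"]) (use fin in \<open>auto simp: A_def\<close>)
  have "(\<Sum>\<tau>\<in>T. incidence \<sigma> \<tau> * incidence \<tau> \<rho>) = (\<Sum>\<tau>\<in>T'. incidence \<sigma> \<tau> * (incidence \<tau> \<rho> :: 'k))"
    using T(1) ne by (simp add: T'_def incidence_def)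
  also have "\<dots> = (\<Sum>\<tau>\<in>T'. \<Sum>v | v \<in> \<sigma> \<and> \<sigma> - {v} = \<tau>. face_sign \<sigma> v * incidence (\<sigma> - {v}) \<rho>)"
    by (rule sum.cong[OF refl]) (simp add: incidence_def[of \<sigma>] sum_distrib_right)
  also have "\<dots> = (\<Sum>v\<in>\<sigma>. face_sign \<sigma> v * incidence (\<sigma> - {v}) \<rho>)"
    by (rule sum.group[OF fin T'(1), of "\<lambda>v. \<sigma> - {v}"]) (use T'(2) in blast)
  also have "\<dots> = (\<Sum>v\<in>\<sigma>. \<Sum>w | w \<in> \<sigma> - {v} \<and> \<sigma> - {v} - {w} = \<rho>. g (v, w))"
    by (simp add: incidence_def[of _ \<rho>] sum_distrib_left g_def)
  also have "\<dots> = sum g (SIGMA v:\<sigma>. {w. w \<in> \<sigma> - {v} \<and> \<sigma> - {v} - {w} = \<rho>})"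
    by (subst sum.Sigma) (use fin in auto)
  also have "(SIGMA v:\<sigma>. {w. w \<in> \<sigma> - {v} \<and> \<sigma> - {v} - {w} = \<rho>}) = A"
    by (auto simp: A_def)
  also have "sum g A = sum g {p \<in> A. vertex_less (fst p) (snd p)} + sum g {p \<in> A. vertex_less (snd p) (fst p)}"
  proof -
    let ?B = "{p \<in> A. vertex_less (fst p) (snd p)}" and ?C = "{p \<in> A. vertex_less (snd p) (fst p)}"
    have "A = ?B \<union> ?C"
      using vertex_less_linear by (fastforce simp: A_def)
    then have "sum g A = sum g (?B \<union> ?C)"
      by (rule arg_cong)
    also have "\<dots> = sum g ?B + sum g ?C"
    proof (rule sum.union_disjoint)
      show "finite ?B" "finite ?C"
        by (rule finite_subset[OF _ finA], rule Collect_restrict)+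
      show "?B \<inter> ?C = {}"
      proof (rule equals0I)
        fix p assume "p \<in> ?B \<inter> ?C"
        then have "vertex_less (fst p) (snd p)" "vertex_less (snd p) (fst p)" by blast+
        then show False using vertex_less_asym[of "fst p" "snd p"] by blast
      qed
    qed
    finally show ?thesis .
  qed
  also have "sum g {p \<in> A. vertex_less (snd p) (fst p)} = (\<Sum>p\<in>{p \<in> A. vertex_less (fst p) (snd p)}. g (prod.swap p))"
    by (rule sum.reindex_bij_witness[of _ prod.swap prod.swap]) (auto simp: A_def)
  also have "\<dots> = (\<Sum>p\<in>{p \<in> A. vertex_less (fst p) (snd p)}. - g p)"
    by (rule sum.cong[OF refl]) (use face_sign_swap[OF fin] in \<open>auto simp: A_def g_def\<close>)
  also have "\<dots> = - sum g {p \<in> A. vertex_less (fst p) (snd p)}" by (simp add: sum_negf)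
  finally show ?thesis by simp
qed

lemma boundary_nonzero:
  fixes c :: "'a set \<Rightarrow> 'k::field"
  assumes "boundary c \<tau> \<noteq> 0"
  obtains \<sigma> v where "c \<sigma> \<noteq> 0" "v \<in> \<sigma>" "\<tau> = \<sigma> - {v}" "\<tau> \<noteq> {}"
proof -
  from assms have ne: "\<tau> \<noteq> {}" and
    "(\<Sum>\<sigma> | c \<sigma> \<noteq> 0. c \<sigma> * (\<Sum>v | v \<in> \<sigma> \<and> \<sigma> - {v} = \<tau>. face_sign \<sigma> v)) \<noteq> 0"
    by (auto simp: boundary_def split: if_splits)
  from sum.not_neutral_contains_not_neutral[OF this(2)] obtain \<sigma> where
    "c \<sigma> \<noteq> 0" "(\<Sum>v | v \<in> \<sigma> \<and> \<sigma> - {v} = \<tau>. face_sign \<sigma> v :: 'k) \<noteq> 0" by auto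
  moreover from sum.not_neutral_contains_not_neutral[OF this(2)] obtain v where "v \<in> \<sigma>" "\<sigma> - {v} = \<tau>" by auto
  ultimately show thesis using that ne by auto
qed

lemma boundary_boundary:
  assumes fin: "finite {\<sigma>. c \<sigma> \<noteq> 0}" and finS: "\<And>\<sigma>. c \<sigma> \<noteq> 0 \<Longrightarrow> finite \<sigma>"
  shows "boundary (boundary c) = (\<lambda>_. 0 :: 'k::field)"
proof
  fix \<rho>
  define S where "S = {\<sigma>. c \<sigma> \<noteq> 0}"
  define T where "T = Pow (\<Union>S) - {{}}"
  have "finite (\<Union>S)" using fin finS by (auto simp: S_def)
  then have finT: "finite T" by (simp add: T_def)
  have subT: "{\<tau>. boundary c \<tau> \<noteq> 0} \<subseteq> T"
    by (auto simp: T_def S_def elim!: boundary_nonzero)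
  have b: "boundary c \<tau> = (\<Sum>\<sigma>\<in>S. c \<sigma> * incidence \<sigma> \<tau>)" if "\<tau> \<in> T" for \<tau>
    using that boundary_eq[of S c \<tau>] fin by (auto simp: S_def T_def)
  have "(\<Sum>\<tau>\<in>T. boundary c \<tau> * incidence \<tau> \<rho>) = (\<Sum>\<tau>\<in>T. \<Sum>\<sigma>\<in>S. c \<sigma> * (incidence \<sigma> \<tau> * incidence \<tau> \<rho>))"
    by (rule sum.cong[OF refl]) (simp add: b sum_distrib_right mult.assoc)
  also have "\<dots> = (\<Sum>\<sigma>\<in>S. c \<sigma> * (\<Sum>\<tau>\<in>T. incidence \<sigma> \<tau> * incidence \<tau> \<rho>))"
    by (subst sum.swap) (simp add: sum_distrib_left)
  also have "\<dots> = 0"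
  proof (rule sum.neutral, rule ballI)
    fix \<sigma> assume "\<sigma> \<in> S"
    then have "(\<Sum>\<tau>\<in>T. incidence \<sigma> \<tau> * incidence \<tau> \<rho>) = (0::'k)"
      by (intro incidence_incidence finT) (use finS in \<open>auto simp: S_def T_def\<close>)
    then show "c \<sigma> * (\<Sum>\<tau>\<in>T. incidence \<sigma> \<tau> * incidence \<tau> \<rho>) = 0" by simp
  qed
  finally show "boundary (boundary c) \<rho> = 0" using boundary_eq[OF finT subT, of \<rho>] by simp
qed

lemma simplicial_chains_zero: "(\<lambda>_. 0) \<in> simplicial_chains k K" by (simp add: simplicial_chains_def)

lemma simplicial_chains_add: 
  assumes "c \<in> simplicial_chains k K" "d \<in> simplicial_chains k K" shows "(\<lambda>\<sigma>. c \<sigma> + d \<sigma>) \<in> simplicial_chains k K"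
proof -
  have "{\<sigma>. c \<sigma> + d \<sigma> \<noteq> 0} \<subseteq> {\<sigma>. c \<sigma> \<noteq> 0} \<union> {\<sigma>. d \<sigma> \<noteq> 0}" by auto
  with assms show ?thesis unfolding simplicial_chains_def by (auto intro: finite_subset)
qed

lemma simplicial_chains_smult: 
  assumes "c \<in> simplicial_chains k K" shows "(\<lambda>\<sigma>. a * c \<sigma>) \<in> simplicial_chains k K"
proof -
  have "{\<sigma>. a * c \<sigma> \<noteq> 0} \<subseteq> {\<sigma>. c \<sigma> \<noteq> 0}" by auto
  with assms show ?thesis unfolding simplicial_chains_def by (auto intro: finite_subset)
qed

lemma simplicial_chains_mono: "K \<subseteq> L \<Longrightarrow> simplicial_chains k K \<subseteq> simplicial_chains k L" by (auto simp: simplicial_chains_def)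

lemma boundary_zero: "boundary (\<lambda>_. 0) = (\<lambda>_. 0)" by (auto simp: boundary_def)

lemma boundary_add:
  assumes "c \<in> simplicial_chains k K" "d \<in> simplicial_chains k K"
  shows "boundary (\<lambda>\<sigma>. c \<sigma> + d \<sigma>) = (\<lambda>\<tau>. boundary c \<tau> + boundary d \<tau>)"
proof
  fix \<tau>
  let ?S = "{\<sigma>. c \<sigma> \<noteq> 0} \<union> {\<sigma>. d \<sigma> \<noteq> 0}"
  have S: "finite ?S" using assms by (simp add: simplicial_chains_def)
  show "boundary (\<lambda>\<sigma>. c \<sigma> + d \<sigma>) \<tau> = boundary c \<tau> + boundary d \<tau>"
    by (subst (1 2 3) boundary_eq[OF S]) (auto simp: ring_distribs sum.distrib)
qed

lemma boundary_smult:
  assumes "c \<in> simplicial_chains k K"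
  shows "boundary (\<lambda>\<sigma>. a * c \<sigma>) = (\<lambda>\<tau>. a * boundary c \<tau>)"
proof
  fix \<tau>
  let ?S = "{\<sigma>. c \<sigma> \<noteq> 0}"
  have S: "finite ?S" using assms by (simp add: simplicial_chains_def)
  show "boundary (\<lambda>\<sigma>. a * c \<sigma>) \<tau> = a * boundary c \<tau>"
    by (subst (1 2) boundary_eq[OF S]) (auto simp: sum_distrib_left mult.assoc)
qed

lemma boundary_chains:
  assumes "simplicial_complex K" "c \<in> simplicial_chains (k + 1) K"
  shows "boundary c \<in> simplicial_chains k K"
proof -
  have sub: "{\<tau>. boundary c \<tau> \<noteq> 0} \<subseteq> {\<tau> \<in> K. card \<tau> = k + 1}"
  proof
    fix \<tau> assume "\<tau> \<in> {\<tau>. boundary c \<tau> \<noteq> 0}"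
    then have "boundary c \<tau> \<noteq> 0" by simp
    then obtain \<sigma> v where *: "c \<sigma> \<noteq> 0" "v \<in> \<sigma>" "\<tau> = \<sigma> - {v}" "\<tau> \<noteq> {}"
      by (rule boundary_nonzero)
    with assms(2) have "\<sigma> \<in> K" "card \<sigma> = k + 2" by (auto simp: simplicial_chains_def)
    with * assms(1) show "\<tau> \<in> {\<tau> \<in> K. card \<tau> = k + 1}" by (auto simp: simplicial_complex_def)
  qed
  have "{\<tau>. boundary c \<tau> \<noteq> 0} \<subseteq> Pow (\<Union>{\<sigma>. c \<sigma> \<noteq> 0})" by (auto elim!: boundary_nonzero)
  moreover have "finite (\<Union>{\<sigma>. c \<sigma> \<noteq> 0})" 
    using assms by (auto simp: simplicial_chains_def simplicial_complex_def)
  ultimately have "finite {\<tau>. boundary c \<tau> \<noteq> 0}" by (meson finite_Pow_iff finite_subset)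
  with sub show ?thesis by (simp add: simplicial_chains_def)
qed

lemma boundaries_cycles:
  assumes "simplicial_complex K"
  shows "boundaries k K \<subseteq> cycles k K"
proof -
  have "boundary (boundary c) = (\<lambda>_. 0)" if "c \<in> simplicial_chains (k+1) K" for c :: "_ \<Rightarrow> 'b"
    using that assms by (intro boundary_boundary) (auto simp: simplicial_chains_def simplicial_complex_def)
  then show ?thesis using boundary_chains[OF assms] by (auto simp: boundaries_def cycles_def)
qed

lemma field_class_ring: "field (class_ring :: 'k::field ring)"
  by (rule class_field.field_axioms)

lemma vectorspace_class_ringI:
  assumes "\<And>x y. x \<in> carrier V \<Longrightarrow> y \<in> carrier V \<Longrightarrow> x \<oplus>\<^bsub>V\<^esub> y \<in> carrier V"
    and "\<zero>\<^bsub>V\<^esub> \<in> carrier V"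
    and "\<And>a x. x \<in> carrier V \<Longrightarrow> a \<odot>\<^bsub>V\<^esub> x \<in> carrier V"
    and "\<And>x y z. x \<in> carrier V \<Longrightarrow> y \<in> carrier V \<Longrightarrow> z \<in> carrier V \<Longrightarrow> (x \<oplus>\<^bsub>V\<^esub> y) \<oplus>\<^bsub>V\<^esub> z = x \<oplus>\<^bsub>V\<^esub> (y \<oplus>\<^bsub>V\<^esub> z)"
    and "\<And>x y. x \<in> carrier V \<Longrightarrow> y \<in> carrier V \<Longrightarrow> x \<oplus>\<^bsub>V\<^esub> y = y \<oplus>\<^bsub>V\<^esub> x"
    and "\<And>x. x \<in> carrier V \<Longrightarrow> \<zero>\<^bsub>V\<^esub> \<oplus>\<^bsub>V\<^esub> x = x"
    and "\<And>x. x \<in> carrier V \<Longrightarrow> (- 1) \<odot>\<^bsub>V\<^esub> x \<oplus>\<^bsub>V\<^esub> x = \<zero>\<^bsub>V\<^esub>"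
    and "\<And>a b x. x \<in> carrier V \<Longrightarrow> (a + b) \<odot>\<^bsub>V\<^esub> x = a \<odot>\<^bsub>V\<^esub> x \<oplus>\<^bsub>V\<^esub> b \<odot>\<^bsub>V\<^esub> x"
    and "\<And>a x y. x \<in> carrier V \<Longrightarrow> y \<in> carrier V \<Longrightarrow> a \<odot>\<^bsub>V\<^esub> (x \<oplus>\<^bsub>V\<^esub> y) = a \<odot>\<^bsub>V\<^esub> x \<oplus>\<^bsub>V\<^esub> a \<odot>\<^bsub>V\<^esub> y"
    and "\<And>a b x. x \<in> carrier V \<Longrightarrow> (a * b) \<odot>\<^bsub>V\<^esub> x = a \<odot>\<^bsub>V\<^esub> (b \<odot>\<^bsub>V\<^esub> x)"
    and "\<And>x. x \<in> carrier V \<Longrightarrow> 1 \<odot>\<^bsub>V\<^esub> x = x"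
  shows "vectorspace (class_ring :: 'k::field ring) V"
proof -
  have "abelian_group V"
  proof (rule abelian_groupI)
    fix x assume "x \<in> carrier V"
    then show "\<exists>y\<in>carrier V. y \<oplus>\<^bsub>V\<^esub> x = \<zero>\<^bsub>V\<^esub>" using assms(3,7) by blast
  qed (use assms in auto)
  moreover have "cring (class_ring :: 'k ring)" by (rule class_cring.cring_axioms)
  ultimately have "Module.module (class_ring :: 'k ring) V"
    by (intro moduleI) (use assms in auto)
  then show ?thesis unfolding vectorspace_def using field_class_ring by blast
qed

lemma vectorspace_cycle_space: "vectorspace (class_ring :: 'k::field ring) (cycle_space k K)"
proof (rule vectorspace_class_ringI, goal_cases)
  case (1 x y)
  then show ?case by (auto simp: cycle_space_def cycles_def simplicial_chains_add boundary_add)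
next
  case 2 show ?case by (auto simp: cycle_space_def cycles_def simplicial_chains_zero boundary_zero)
next
  case (3 a x)
  then show ?case by (auto simp: cycle_space_def cycles_def simplicial_chains_smult boundary_smult)
qed (auto simp: cycle_space_def algebra_simps)

lemma submodule_boundaries:
  assumes "simplicial_complex K"
  shows "submodule (class_ring :: 'k::field ring) (boundaries k K) (cycle_space k K)"
proof -
  interpret vectorspace "class_ring :: 'k ring" "cycle_space k K" by (rule vectorspace_cycle_space)
  show ?thesis
  proof (rule submodule.intro)
    show "Module.module (class_ring :: 'k ring) (cycle_space k K)" by unfold_locales
    show "boundaries k K \<subseteq> carrier (cycle_space k K)"
      using boundaries_cycles[OF assms] by (simp add: cycle_space_def)
    show "v \<oplus>\<^bsub>cycle_space k K\<^esub> w \<in> boundaries k K" if vw: "v \<in> boundaries k K" "w \<in> boundaries k K" for v w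
    proof -
      from vw obtain c d where "c \<in> simplicial_chains (k+1) K" "v = boundary c" "d \<in> simplicial_chains (k+1) K" "w = boundary d"
        by (auto simp: boundaries_def)
      then show ?thesis unfolding boundaries_def
        by (intro image_eqI[OF _ simplicial_chains_add[of c _ _ d]]) (auto simp: cycle_space_def boundary_add)
    qed
    show "\<zero>\<^bsub>cycle_space k K\<^esub> \<in> boundaries k K" unfolding boundaries_def
        by (intro image_eqI[OF _ simplicial_chains_zero]) (auto simp: cycle_space_def boundary_zero)
    show "a \<odot>\<^bsub>cycle_space k K\<^esub> v \<in> boundaries k K" if vw: "v \<in> boundaries k K" for a v
    proof -
      from vw obtain c where "c \<in> simplicial_chains (k+1) K" "v = boundary c"
        by (auto simp: boundaries_def)
      then show ?thesis unfolding boundaries_def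
        by (intro image_eqI[OF _ simplicial_chains_smult[of c _ _ a]]) (auto simp: cycle_space_def boundary_smult)
    qed
  qed
qed

lemma homology_coset: "boundaries k K +>\<^bsub>cycle_space k K\<^esub> z = {\<lambda>\<sigma>. b \<sigma> + z \<sigma> | b. b \<in> boundaries k K}"
  by (auto simp: a_r_coset_def' cycle_space_def)

lemma carrier_homology:
  "carrier (homology k K) = (\<lambda>z. boundaries k K +>\<^bsub>cycle_space k K\<^esub> z) ` cycles k K"
  by (auto simp: homology_def quotient_space_def A_RCOSETS_def' cycle_space_def)

context
  fixes K :: "'a set set" and k :: nat
  assumes K: "simplicial_complex K"
begin

lemma boundaries_zero: "(\<lambda>_. 0) \<in> boundaries k K"
  using submodule.zero_closed[OF submodule_boundaries[OF K]] by (simp add: cycle_space_def)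
lemma boundaries_add: "b \<in> boundaries k K \<Longrightarrow> c \<in> boundaries k K \<Longrightarrow> (\<lambda>\<sigma>. b \<sigma> + c \<sigma>) \<in> boundaries k K"
  using submodule.m_closed[OF submodule_boundaries[OF K]] by (simp add: cycle_space_def)
lemma boundaries_smult: "b \<in> boundaries k K \<Longrightarrow> (\<lambda>\<sigma>. a * b \<sigma>) \<in> boundaries k K"
  using submodule.smult_closed[OF submodule_boundaries[OF K]] by (simp add: cycle_space_def)
lemma boundaries_neg: "b \<in> boundaries k K \<Longrightarrow> (\<lambda>\<sigma>. - b \<sigma>) \<in> boundaries k K"
  using boundaries_smult[of b "-1"] by simp

abbreviation homology_class where "homology_class z \<equiv> boundaries k K +>\<^bsub>cycle_space k K\<^esub> z"

lemma mem_homology_class: "x \<in> homology_class z \<longleftrightarrow> (\<lambda>\<sigma>. x \<sigma> - z \<sigma>) \<in> boundaries k K"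
  unfolding homology_coset
  by (auto simp: fun_eq_iff intro!: exI[of _ "\<lambda>\<sigma>. x \<sigma> - z \<sigma>"])

lemma homology_class_eq_iff: "homology_class z = homology_class w \<longleftrightarrow> (\<lambda>\<sigma>. z \<sigma> - w \<sigma>) \<in> boundaries k K"
proof
  assume "homology_class z = homology_class w"
  moreover have "z \<in> homology_class z" using boundaries_zero by (simp add: mem_homology_class)
  ultimately show "(\<lambda>\<sigma>. z \<sigma> - w \<sigma>) \<in> boundaries k K" by (simp add: mem_homology_class)
next
  assume a: "(\<lambda>\<sigma>. z \<sigma> - w \<sigma>) \<in> boundaries k K"
  show "homology_class z = homology_class w"
  proof (rule Set.set_eqI)
    fix x
    have "(\<lambda>\<sigma>. x \<sigma> - w \<sigma>) \<in> boundaries k K" if "(\<lambda>\<sigma>. x \<sigma> - z \<sigma>) \<in> boundaries k K"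
      using boundaries_add[OF that a] by simp
    moreover have "(\<lambda>\<sigma>. x \<sigma> - z \<sigma>) \<in> boundaries k K" if "(\<lambda>\<sigma>. x \<sigma> - w \<sigma>) \<in> boundaries k K"
      using boundaries_add[OF that boundaries_neg[OF a]] by simp
    ultimately show "x \<in> homology_class z \<longleftrightarrow> x \<in> homology_class w"
      unfolding mem_homology_class by (rule iffI)
  qed
qed

lemma homology_class_self: "z \<in> homology_class z" using boundaries_zero by (simp add: mem_homology_class)

lemma homology_add: "homology_class z \<oplus>\<^bsub>homology k K\<^esub> homology_class w = homology_class (\<lambda>\<sigma>. z \<sigma> + w \<sigma>)"
proof -
  have "x \<in> homology_class (\<lambda>\<sigma>. z \<sigma> + w \<sigma>) \<longleftrightarrow> (\<exists>c\<in>homology_class z. \<exists>d\<in>homology_class w. x = (\<lambda>\<sigma>. c \<sigma> + d \<sigma>))" for x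
  proof
    assume "x \<in> homology_class (\<lambda>\<sigma>. z \<sigma> + w \<sigma>)"
    then have "(\<lambda>\<sigma>. x \<sigma> - w \<sigma>) \<in> homology_class z" by (simp add: mem_homology_class algebra_simps)
    then show "\<exists>c\<in>homology_class z. \<exists>d\<in>homology_class w. x = (\<lambda>\<sigma>. c \<sigma> + d \<sigma>)"
      by (rule bexI[rotated]) (rule bexI[OF _ homology_class_self[of w]], auto)
  next
    assume "\<exists>c\<in>homology_class z. \<exists>d\<in>homology_class w. x = (\<lambda>\<sigma>. c \<sigma> + d \<sigma>)"
    then obtain c d where "c \<in> homology_class z" "d \<in> homology_class w" "x = (\<lambda>\<sigma>. c \<sigma> + d \<sigma>)" by auto
    then show "x \<in> homology_class (\<lambda>\<sigma>. z \<sigma> + w \<sigma>)" 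
      using boundaries_add[of "\<lambda>\<sigma>. c \<sigma> - z \<sigma>" "\<lambda>\<sigma>. d \<sigma> - w \<sigma>"] by (simp add: mem_homology_class algebra_simps)
  qed
  then show ?thesis
    by (auto simp: homology_def quotient_space_def set_add_def' cycle_space_def)
qed

lemma homology_smult: "a \<odot>\<^bsub>homology k K\<^esub> homology_class z = homology_class (\<lambda>\<sigma>. a * z \<sigma>)"
proof -
  have "homology_class (\<lambda>\<sigma>. a * x \<sigma>) = homology_class (\<lambda>\<sigma>. a * z \<sigma>)" if "x \<in> homology_class z" for x
    using that boundaries_smult[of "\<lambda>\<sigma>. x \<sigma> - z \<sigma>" a] by (simp add: homology_class_eq_iff mem_homology_class algebra_simps)
  then have "(\<Union>x\<in>homology_class z. homology_class (\<lambda>\<sigma>. a * x \<sigma>)) = homology_class (\<lambda>\<sigma>. a * z \<sigma>)" using homology_class_self[of z] by blast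
  then show ?thesis
    by (simp add: homology_def quotient_space_def) (simp add: cycle_space_def)
qed

lemma homology_zero: "\<zero>\<^bsub>homology k K\<^esub> = homology_class (\<lambda>_. 0)"
proof -
  have "homology_class (\<lambda>_. 0) = boundaries k K" by (auto simp: mem_homology_class)
  then show ?thesis unfolding homology_def quotient_space_def by (metis ring.select_convs(1))
qed

lemma cycles_closed: 
  "(\<lambda>_. 0) \<in> cycles k K" 
  "z \<in> cycles k K \<Longrightarrow> w \<in> cycles k K \<Longrightarrow> (\<lambda>\<sigma>. z \<sigma> + w \<sigma>) \<in> cycles k K"
  "z \<in> cycles k K \<Longrightarrow> (\<lambda>\<sigma>. a * z \<sigma>) \<in> cycles k K"
  by (auto simp: cycles_def simplicial_chains_zero boundary_zero simplicial_chains_add boundary_add simplicial_chains_smult boundary_smult)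

lemma vectorspace_homology: "vectorspace (class_ring :: 'k::field ring) (homology k K)"
  apply (rule vectorspace_class_ringI)
  apply (auto simp: carrier_homology homology_add homology_smult homology_zero intro: cycles_closed)
  apply (simp_all add: algebra_simps)
  done

end

lemma homology_inclusion_class:
  assumes "simplicial_complex K" "simplicial_complex L" "K \<subseteq> L"
  shows "homology_inclusion k L (boundaries k K +>\<^bsub>cycle_space k K\<^esub> z) = boundaries k L +>\<^bsub>cycle_space k L\<^esub> z"
proof -
  have sub: "boundaries k K \<subseteq> boundaries k L"
    unfolding boundaries_def using simplicial_chains_mono[OF assms(3)] by blast
  have "boundaries k L +>\<^bsub>cycle_space k L\<^esub> x = boundaries k L +>\<^bsub>cycle_space k L\<^esub> z"
    if "x \<in> boundaries k K +>\<^bsub>cycle_space k K\<^esub> z" for x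
    using that sub by (auto simp: homology_class_eq_iff[OF assms(2)] mem_homology_class[OF assms(1)])
  then show ?thesis unfolding homology_inclusion_def using homology_class_self[OF assms(1), of z] by blast
qed

lemma persistence_vector_space_homology:
  assumes "\<And>t. simplicial_complex (F t)" "mono F"
  shows "persistence_vector_space (persistent_homology k F :: ('k::field, _) persistence)"
proof (rule persistence_vector_space.intro)
  fix s t :: real assume le: "s \<le> t"
  then have sub: "F s \<subseteq> F t" using assms(2) by (auto dest: monoD)
  note h = homology_inclusion_class[OF assms(1) assms(1) sub]
  have cyc: "cycles k (F s) \<subseteq> cycles k (F t)" using simplicial_chains_mono[OF sub] by (auto simp: cycles_def)
  have V: "vectorspace class_ring (homology k (F t) :: ('k, _) module)" for t
    by (rule vectorspace_homology[OF assms(1)])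
  have "homology_inclusion k (F t) \<in> LinearCombinations.module_hom class_ring (homology k (F s)) (homology k (F t) :: ('k, _) module)"
    using cyc by (auto simp: LinearCombinations.module_hom_def carrier_homology h homology_add[OF assms(1)] homology_smult[OF assms(1)])
  then show "linear_map class_ring (space_at (persistent_homology k F :: ('k, _) persistence) s) (space_at (persistent_homology k F :: ('k, _) persistence) t)
     (map_at (persistent_homology k F :: ('k, _) persistence) s t)"
    using V V[unfolded vectorspace_def]
    by (simp add: persistent_homology_def linear_map_def mod_hom_def mod_hom_axioms_def)
next
  fix t x assume "x \<in> carrier (space_at (persistent_homology k F :: ('k, _) persistence) t)"
  then show "map_at (persistent_homology k F) t t x = x"
    using homology_inclusion_class[OF assms(1) assms(1) order_refl]
    by (auto simp: persistent_homology_def carrier_homology)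
next
  fix r s t :: real and x assume *: "r \<le> s" "s \<le> t" "x \<in> carrier (space_at (persistent_homology k F :: ('k, _) persistence) r)"
  then have "F r \<subseteq> F s" "F s \<subseteq> F t" "F r \<subseteq> F t" using assms(2) by (metis monoD order_trans)+
  with * show "map_at (persistent_homology k F) s t (map_at (persistent_homology k F) r s x) = map_at (persistent_homology k F) r t x"
    by (auto simp: persistent_homology_def carrier_homology homology_inclusion_class[OF assms(1) assms(1)])
qed

lemma simplicial_complex_dowker:
  assumes "finite X"
  shows "simplicial_complex (dowker_sink X \<omega> \<delta>)" "simplicial_complex (dowker_source X \<omega> \<delta>)"
  unfolding simplicial_complex_def dowker_sink_def dowker_source_def
  using finite_subset[OF _ assms] by blast+

lemma mono_dowker: "mono (dowker_sink X \<omega>)" "mono (dowker_source X \<omega>)"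
proof -
  show "mono (dowker_sink X \<omega>)"
  proof (rule monoI, rule subsetI)
    fix \<delta> \<epsilon> \<sigma> assume "\<delta> \<le> \<epsilon>" "\<sigma> \<in> dowker_sink X \<omega> \<delta>"
    then show "\<sigma> \<in> dowker_sink X \<omega> \<epsilon>"
      unfolding dowker_sink_def mem_Collect_eq using order_trans[of _ \<delta> \<epsilon>] by blast
  qed
  show "mono (dowker_source X \<omega>)"
  proof (rule monoI, rule subsetI)
    fix \<delta> \<epsilon> \<sigma> assume "\<delta> \<le> \<epsilon>" "\<sigma> \<in> dowker_source X \<omega> \<delta>"
    then show "\<sigma> \<in> dowker_source X \<omega> \<epsilon>"
      unfolding dowker_source_def mem_Collect_eq using order_trans[of _ \<delta> \<epsilon>] by blast
  qed
qed

lemma persistence_vector_space_dowker: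
  assumes "finite X"
  shows "persistence_vector_space (persistent_homology k (dowker_sink X \<omega>) :: ('k::field, _) persistence)"
    and "persistence_vector_space (persistent_homology k (dowker_source X \<omega>) :: ('k, _) persistence)"
  by (intro persistence_vector_space_homology simplicial_complex_dowker mono_dowker assms)+


lemma direct_sum_interval_modules:
  fixes ps :: "(ereal \<times> ereal) list"
  defines "V \<equiv> persistence_direct_sum (map interval_module ps) :: ('k::field, nat \<Rightarrow> 'k) persistence"
  shows "f \<in> carrier (space_at V t) \<longleftrightarrow>
      (\<forall>i. if i < length ps then t \<in> interval (ps ! i) \<or> f i = 0 else f i = undefined)"
    and "f \<oplus>\<^bsub>space_at V t\<^esub> g = (\<lambda>i. if i < length ps then f i + g i else undefined)"
    and "\<zero>\<^bsub>space_at V t\<^esub> = (\<lambda>i. if i < length ps then 0 else undefined)"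
    and "a \<odot>\<^bsub>space_at V t\<^esub> f = (\<lambda>i. if i < length ps then a * f i else undefined)"
    and "map_at V s t f = (\<lambda>i. if i < length ps
      then if s \<in> interval (ps ! i) \<and> t \<in> interval (ps ! i) then f i else 0 else undefined)"
  by (auto simp: V_def persistence_direct_sum_def interval_module_def PiE_iff extensional_def
      restrict_def split: if_splits)

lemma interval_convex:
  assumes "r \<le> s" "s \<le> t" "r \<in> interval p" "t \<in> interval p"
  shows "s \<in> interval p"
proof -
  have "fst p \<le> ereal r" "ereal r \<le> ereal s" "ereal s \<le> ereal t" "ereal t < snd p"
    using assms by (simp_all add: interval_def)
  then show ?thesis unfolding interval_def mem_Collect_eq by (meson order_trans le_less_trans)
qed

lemma persistence_vector_space_direct_sum_interval_modules:
  "persistence_vector_space (persistence_direct_sum (map interval_module ps) :: ('k::field, nat \<Rightarrow> 'k) persistence)"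
  (is "persistence_vector_space ?V")
proof (rule persistence_vector_space.intro)
  note ds = direct_sum_interval_modules
  have V: "vectorspace class_ring (space_at ?V t)" for t
  proof (rule vectorspace_class_ringI, goal_cases)
    case (1 x y)
    then show ?case unfolding ds by (metis add_0)
  next
    case (3 a x)
    then show ?case unfolding ds by (metis mult_zero_right)
  next
    case (6 x)
    then show ?case unfolding ds by (intro ext) (metis add_0)
  next
    case (11 x)
    then show ?case unfolding ds by (intro ext) (metis mult_1)
  qed (unfold ds, simp_all add: algebra_simps fun_eq_iff)
  fix s t :: real
  have "map_at ?V s t \<in> LinearCombinations.module_hom class_ring (space_at ?V s) (space_at ?V t)"
    unfolding LinearCombinations.module_hom_def by (simp add: ds fun_eq_iff Pi_def)
  then show "linear_map class_ring (space_at ?V s) (space_at ?V t) (map_at ?V s t)"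
    using V V[unfolded vectorspace_def] by (simp add: linear_map_def mod_hom_def mod_hom_axioms_def)
next
  fix t x assume "x \<in> carrier (space_at ?V t)"
  then show "map_at ?V t t x = x"
    unfolding direct_sum_interval_modules by (intro ext) metis
next
  fix r s t :: real and x
  assume "r \<le> s" "s \<le> t"
  then show "map_at ?V s t (map_at ?V r s x) = map_at ?V r t x"
    unfolding direct_sum_interval_modules using interval_convex[of r s t] by (intro ext) simp
qed

end

theory Submission
  imports Defs
begin

text \<open>
  A relation \<open>R\<close> between \<open>X\<close> and \<open>Y\<close> spans the augmented double complex of pairs \<open>(\<sigma>, \<tau>)\<close> with
  \<open>\<sigma> \<times> \<tau> \<subseteq> R\<close>. For fixed \<open>\<sigma> \<noteq> {}\<close> the admissible \<open>\<tau>\<close> are the faces of a full simplex, so rows, and by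
  symmetry columns, are exact; the zigzags of the double complex therefore match the \<open>k\<close>-cycles of the two
  Dowker complexes of \<open>R\<close> up to boundaries. A zigzag for \<open>R\<close> is also one for every larger relation,
  hence this isomorphism is natural in \<open>R\<close>, and the two persistent homologies are isomorphic. The
  diagram only depends on the isomorphism class.
\<close>

section \<open>Isomorphic persistence vector spaces\<close>

lemma linear_map_comp:
  assumes "linear_map K U V f" "linear_map K V W g"
  shows "linear_map K U W (g \<circ> f)"
proof -
  interpret f: linear_map K U V f by (rule assms)
  interpret g: linear_map K V W g by (rule assms)
  have "g \<circ> f \<in> LinearCombinations.module_hom K U W"
    using f.f_hom g.f_hom by (auto simp: LinearCombinations.module_hom_def)
  then show ?thesis using f.V.vectorspace_axioms g.W.vectorspace_axioms
    by (simp add: linear_map_def mod_hom_def mod_hom_axioms_def vectorspace_def)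
qed

lemma linear_map_inv_into:
  assumes "linear_map K V W f" and bij: "bij_betw f (carrier V) (carrier W)"
  shows "linear_map K W V (inv_into (carrier V) f)"
proof -
  interpret linear_map K V W f by (rule assms)
  let ?g = "inv_into (carrier V) f"
  have fg: "f (?g y) = y" and g: "?g y \<in> carrier V" if "y \<in> carrier W" for y
    using that bij bij_betw_inv_into_right bij_betwE[OF bij_betw_inv_into] by fast+
  have gf: "?g (f x) = x" if "x \<in> carrier V" for x
    using that bij bij_betw_inv_into_left by fast
  have "?g (y \<oplus>\<^bsub>W\<^esub> z) = ?g y \<oplus>\<^bsub>V\<^esub> ?g z" if "y \<in> carrier W" "z \<in> carrier W" for y z
    using gf[of "?g y \<oplus>\<^bsub>V\<^esub> ?g z"] that by (simp add: fg g)
  moreover have "?g (a \<odot>\<^bsub>W\<^esub> y) = a \<odot>\<^bsub>V\<^esub> ?g y" if "a \<in> carrier K" "y \<in> carrier W" for a y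
    using gf[of "a \<odot>\<^bsub>V\<^esub> ?g y"] that by (simp add: fg g)
  ultimately have "?g \<in> LinearCombinations.module_hom K W V"
    by (auto simp: LinearCombinations.module_hom_def g)
  then show ?thesis using V.vectorspace_axioms W.vectorspace_axioms
    by (simp add: linear_map_def mod_hom_def mod_hom_axioms_def vectorspace_def)
qed

lemma persistence_isomorphic_trans:
  assumes "persistence_isomorphic U V" "persistence_isomorphic V W"
  shows "persistence_isomorphic U W"
proof -
  from assms(1) obtain f where f:
    "\<And>t. linear_map class_ring (space_at U t) (space_at V t) (f t)"
    "\<And>t. bij_betw (f t) (carrier (space_at U t)) (carrier (space_at V t))"
    "\<And>s t x. s \<le> t \<Longrightarrow> x \<in> carrier (space_at U s) \<Longrightarrow> f t (map_at U s t x) = map_at V s t (f s x)"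
    unfolding persistence_isomorphic_def by blast
  from assms(2) obtain g where g:
    "\<And>t. linear_map class_ring (space_at V t) (space_at W t) (g t)"
    "\<And>t. bij_betw (g t) (carrier (space_at V t)) (carrier (space_at W t))"
    "\<And>s t x. s \<le> t \<Longrightarrow> x \<in> carrier (space_at V s) \<Longrightarrow> g t (map_at V s t x) = map_at W s t (g s x)"
    unfolding persistence_isomorphic_def by blast
  show ?thesis unfolding persistence_isomorphic_def
    by (rule exI[of _ "\<lambda>t. g t \<circ> f t"])
      (auto simp: f(3) g(3) bij_betwE[OF f(2)] intro: linear_map_comp[OF f(1) g(1)] bij_betw_trans[OF f(2) g(2)])
qed

text \<open>The pointwise inverses are again natural. That \<open>V\<close> is a persistence vector
  space keeps its structure maps inside the carriers, where \<open>g t\<close> really undoes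
  \<open>f t\<close>.\<close>

lemma persistence_isomorphic_sym:
  assumes "persistence_vector_space V" "persistence_isomorphic V W"
  shows "persistence_isomorphic W V"
proof -
  interpret persistence_vector_space V by (rule assms)
  from assms(2) obtain f where f:
    "\<And>t. linear_map class_ring (space_at V t) (space_at W t) (f t)"
    "\<And>t. bij_betw (f t) (carrier (space_at V t)) (carrier (space_at W t))"
    "\<And>s t x. s \<le> t \<Longrightarrow> x \<in> carrier (space_at V s) \<Longrightarrow> f t (map_at V s t x) = map_at W s t (f s x)"
    unfolding persistence_isomorphic_def by blast
  define g where "g t = inv_into (carrier (space_at V t)) (f t)" for t
  have g: "g t y \<in> carrier (space_at V t)" "f t (g t y) = y" if "y \<in> carrier (space_at W t)" for t y
    unfolding g_def using that f(2) bij_betw_inv_into_right bij_betwE[OF bij_betw_inv_into] by fast+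
  have "g t (map_at W s t y) = map_at V s t (g s y)"
    if "s \<le> t" "y \<in> carrier (space_at W s)" for s t y
  proof -
    interpret linear_map class_ring "space_at V s" "space_at V t" "map_at V s t"
      by (rule linear[OF that(1)])
    have "map_at V s t (g s y) \<in> carrier (space_at V t)" by (simp add: g that)
    then have "g t (f t (map_at V s t (g s y))) = map_at V s t (g s y)"
      unfolding g_def using f(2) bij_betw_inv_into_left by fast
    then show ?thesis using that by (simp add: f(3) g)
  qed
  then show ?thesis unfolding persistence_isomorphic_def
    by (intro exI[of _ g]) (auto simp: g_def intro: linear_map_inv_into bij_betw_inv_into f(1,2))
qed

text \<open>Composing with the isomorphism or its inverse turns an interval decomposition of one
  side into one of the other, so both \<open>THE\<close> terms describe the same predicate.\<close>

lemma persistence_diagram_cong: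
  assumes "persistence_vector_space V" "persistence_isomorphic V W"
  shows "persistence_diagram V = persistence_diagram W"
proof -
  have "persistence_isomorphic V U \<longleftrightarrow> persistence_isomorphic W U" for U :: "('a, nat \<Rightarrow> 'a) persistence"
    using persistence_isomorphic_trans[OF assms(2), of U]
      persistence_isomorphic_trans[OF persistence_isomorphic_sym[OF assms], of U] by (rule iffI[rotated])
  then show ?thesis by (simp add: persistence_diagram_def interval_decomposition_def)
qed

section \<open>The augmented boundary and its cone contraction\<close>

text \<open>Unlike \<open>boundary\<close>, this keeps the empty face: for finite \<open>X\<close>
  the value at \<open>{}\<close> is the sum of the coefficients of the points. Summing over
  \<open>Pow X\<close> instead of the support gives linearity for arbitrary coefficient
  functions.\<close>

definition aug_boundary :: "'a set \<Rightarrow> ('a set \<Rightarrow> 'k::field) \<Rightarrow> 'a set \<Rightarrow> 'k" where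
  "aug_boundary X c \<tau> = (\<Sum>\<sigma>\<in>Pow X. c \<sigma> * incidence \<sigma> \<tau>)"

text \<open>The cone with apex \<open>s\<close> in coefficient form: \<open>[\<sigma>]\<close> goes
  to \<open>[insert s \<sigma>]\<close> with the sign of \<open>s\<close> in it, and to 0 if
  \<open>s \<in> \<sigma>\<close>.\<close>

definition cone :: "'a \<Rightarrow> ('a set \<Rightarrow> 'k::field) \<Rightarrow> 'a set \<Rightarrow> 'k" where
  "cone s c \<tau> = (if s \<in> \<tau> then face_sign \<tau> s * c (\<tau> - {s}) else 0)"

lemma aug_boundary_zero: "aug_boundary X (\<lambda>_. 0) = (\<lambda>_. 0)"
  by (simp add: aug_boundary_def fun_eq_iff)

lemma aug_boundary_add: "aug_boundary X (\<lambda>\<sigma>. c \<sigma> + d \<sigma>) \<tau> = aug_boundary X c \<tau> + aug_boundary X d \<tau>"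
  by (simp add: aug_boundary_def ring_distribs sum.distrib)

lemma aug_boundary_diff: "aug_boundary X (\<lambda>\<sigma>. c \<sigma> - d \<sigma>) \<tau> = aug_boundary X c \<tau> - aug_boundary X d \<tau>"
  by (simp add: aug_boundary_def ring_distribs sum_subtractf)

lemma aug_boundary_smult: "aug_boundary X (\<lambda>\<sigma>. a * c \<sigma>) \<tau> = a * aug_boundary X c \<tau>"
  by (simp add: aug_boundary_def sum_distrib_left mult.assoc)

lemma aug_boundary_nonzero:
  assumes "aug_boundary X c \<tau> \<noteq> 0"
  obtains \<sigma> v where "\<sigma> \<subseteq> X" "c \<sigma> \<noteq> 0" "v \<in> \<sigma>" "\<tau> = \<sigma> - {v}"
proof -
  from assms obtain \<sigma> where \<sigma>: "\<sigma> \<subseteq> X" "c \<sigma> * incidence \<sigma> \<tau> \<noteq> 0"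
    unfolding aug_boundary_def by (meson Pow_iff sum.not_neutral_contains_not_neutral)
  then have "(\<Sum>v | v \<in> \<sigma> \<and> \<sigma> - {v} = \<tau>. face_sign \<sigma> v :: 'a) \<noteq> 0"
    by (auto simp: incidence_def)
  then obtain v where "v \<in> \<sigma>" "\<sigma> - {v} = \<tau>"
    using sum.not_neutral_contains_not_neutral by blast
  with \<sigma> that show thesis by auto
qed

lemma aug_boundary_aug_boundary:
  assumes "finite X"
  shows "aug_boundary X (aug_boundary X c) = (\<lambda>_. 0)"
proof
  fix \<rho>
  have T: "(\<Sum>\<tau>\<in>Pow X. incidence \<sigma> \<tau> * incidence \<tau> \<rho> :: 'b) = 0" if "\<sigma> \<subseteq> X" for \<sigma>
  proof -
    \<comment> \<open>The empty simplex has no faces, so its term vanishes;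
      \<open>incidence_incidence\<close> is stated for sets without it.\<close>
    have "(\<Sum>\<tau>\<in>Pow X. incidence \<sigma> \<tau> * incidence \<tau> \<rho> :: 'b) = (\<Sum>\<tau>\<in>Pow X - {{}}. incidence \<sigma> \<tau> * incidence \<tau> \<rho>)"
      by (rule sum.mono_neutral_right) (use assms in \<open>auto simp: incidence_def[of "{}"]\<close>)
    also have "\<dots> = 0"
      by (rule incidence_incidence) (use assms that finite_subset in auto)
    finally show ?thesis .
  qed
  have "aug_boundary X (aug_boundary X c) \<rho> = (\<Sum>\<tau>\<in>Pow X. \<Sum>\<sigma>\<in>Pow X. c \<sigma> * (incidence \<sigma> \<tau> * incidence \<tau> \<rho>))"
    by (simp add: aug_boundary_def sum_distrib_right mult.assoc)
  also have "\<dots> = (\<Sum>\<sigma>\<in>Pow X. c \<sigma> * (\<Sum>\<tau>\<in>Pow X. incidence \<sigma> \<tau> * incidence \<tau> \<rho>))"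
    by (subst sum.swap) (simp add: sum_distrib_left)
  also have "\<dots> = 0" using T by simp
  finally show "aug_boundary X (aug_boundary X c) \<rho> = 0" .
qed

lemma aug_boundary_cofaces:
  assumes "finite X" "\<tau> \<subseteq> X"
  shows "aug_boundary X c \<tau> = (\<Sum>v\<in>X - \<tau>. face_sign (insert v \<tau>) v * c (insert v \<tau>))"
proof -
  have "aug_boundary X c \<tau> = (\<Sum>\<sigma>\<in>Pow X. \<Sum>v | v \<in> \<sigma> \<and> \<sigma> - {v} = \<tau>. face_sign \<sigma> v * c \<sigma>)"
    by (simp add: aug_boundary_def incidence_def sum_distrib_left mult.commute)
  also have "\<dots> = (\<Sum>(\<sigma>, v)\<in>(SIGMA \<sigma>:Pow X. {v. v \<in> \<sigma> \<and> \<sigma> - {v} = \<tau>}). face_sign \<sigma> v * c \<sigma>)"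
    by (rule sum.Sigma) (use assms in \<open>auto intro: finite_subset\<close>)
  \<comment> \<open>A coface of \<open>\<tau>\<close> together with its extra vertex is determined
    by that vertex.\<close>
  also have "\<dots> = (\<Sum>v\<in>X - \<tau>. face_sign (insert v \<tau>) v * c (insert v \<tau>))"
    by (rule sum.reindex_bij_witness[of _ "\<lambda>v. (insert v \<tau>, v)" snd]) (use assms in \<open>auto simp: insert_absorb\<close>)
  finally show ?thesis .
qed

lemma face_sign_square: "face_sign \<sigma> v * face_sign \<sigma> v = (1 :: 'k::field)"
  by (simp add: face_sign_def flip: power_mult_distrib)

text \<open>This is \<open>face_sign_swap\<close>, applied to whichever vertex comes first; since
  signs square to 1, a factor can be moved to the other side.\<close>

lemma face_sign_exchange:
  assumes "finite \<sigma>" "v \<in> \<sigma>" "w \<in> \<sigma>" "v \<noteq> w"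
  shows "face_sign \<sigma> v * face_sign \<sigma> w = - (face_sign (\<sigma> - {v}) w * face_sign (\<sigma> - {w}) v :: 'k::field)"
proof -
  have swap: "face_sign \<sigma> w * face_sign (\<sigma> - {w}) v = - (face_sign \<sigma> v * face_sign (\<sigma> - {v}) w :: 'k)"
    using vertex_less_linear[OF assms(4)] face_sign_swap[of \<sigma> v w] face_sign_swap[of \<sigma> w v] assms
    by (metis minus_equation_iff)
  have "face_sign \<sigma> v * face_sign \<sigma> w
      = face_sign \<sigma> v * (face_sign \<sigma> w * face_sign (\<sigma> - {w}) v) * (face_sign (\<sigma> - {w}) v :: 'k)"
    by (simp add: mult.assoc face_sign_square)
  also have "\<dots> = - ((face_sign \<sigma> v * face_sign \<sigma> v) * (face_sign (\<sigma> - {v}) w * face_sign (\<sigma> - {w}) v))"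
    unfolding swap by (simp add: algebra_simps)
  finally show ?thesis by (simp add: face_sign_square)
qed

text \<open>The cone is a contracting homotopy of the full simplex on \<open>X\<close>. It works in
  every degree because the empty face is kept.\<close>

lemma cone_contraction:
  fixes c :: "'a set \<Rightarrow> 'k::field"
  assumes X: "finite X" "s \<in> X" and \<tau>: "\<tau> \<subseteq> X"
  shows "aug_boundary X (cone s c) \<tau> + cone s (aug_boundary X c) \<tau> = c \<tau>"
proof (cases "s \<in> \<tau>")
  case True
  have fin: "finite \<tau>" using X \<tau> finite_subset by blast
  \<comment> \<open>The cofaces of \<open>\<tau> - {s}\<close> arise by adding \<open>s\<close>,
    which gives back \<open>\<tau>\<close> and the term \<open>c \<tau>\<close>, or by adding a
    vertex outside \<open>\<tau>\<close>; the latter cancel against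
    \<open>aug_boundary X (cone s c) \<tau>\<close>.\<close>
  have ins: "X - (\<tau> - {s}) = insert s (X - \<tau>)" using X True by auto
  have "cone s (aug_boundary X c) \<tau> =
      face_sign \<tau> s * (\<Sum>v\<in>insert s (X - \<tau>). face_sign (insert v (\<tau> - {s})) v * c (insert v (\<tau> - {s})))"
    using True \<tau> by (simp add: cone_def aug_boundary_cofaces[OF X(1), of "\<tau> - {s}"] ins subset_insertI2 Diff_subset_conv)
  also have "\<dots> = c \<tau> + (\<Sum>v\<in>X - \<tau>. face_sign \<tau> s * face_sign (insert v (\<tau> - {s})) v * c (insert v (\<tau> - {s})))"
    using X True by (simp add: insert_absorb ring_distribs sum_distrib_left face_sign_square flip: mult.assoc)
  finally have 1: "cone s (aug_boundary X c) \<tau> = \<dots>" .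
  have "aug_boundary X (cone s c) \<tau>
      = (\<Sum>v\<in>X - \<tau>. face_sign (insert v \<tau>) v * face_sign (insert v \<tau>) s * c (insert v \<tau> - {s}))"
    using True by (simp add: aug_boundary_cofaces[OF X(1) \<tau>] cone_def mult.assoc)
  \<comment> \<open>Removing \<open>v\<close> and \<open>s\<close> from
    \<open>insert v \<tau>\<close> in either order gives opposite signs.\<close>
  also have "\<dots> = (\<Sum>v\<in>X - \<tau>. - (face_sign \<tau> s * face_sign (insert v (\<tau> - {s})) v * c (insert v (\<tau> - {s}))))"
  proof (rule sum.cong[OF refl])
    fix v assume v: "v \<in> X - \<tau>"
    have "insert v \<tau> - {v} = \<tau>" "insert v \<tau> - {s} = insert v (\<tau> - {s})" "v \<noteq> s" using v True by auto
    then show "face_sign (insert v \<tau>) v * face_sign (insert v \<tau>) s * c (insert v \<tau> - {s})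
        = - (face_sign \<tau> s * face_sign (insert v (\<tau> - {s})) v * c (insert v (\<tau> - {s})))"
      using face_sign_exchange[of "insert v \<tau>" v s, where 'k = 'k] fin True by simp
  qed
  finally show ?thesis using 1 by (simp add: sum_negf)
next
  case False
  \<comment> \<open>Only the coface \<open>insert s \<tau>\<close> contains the apex, and its sign
    occurs squared.\<close>
  have "aug_boundary X (cone s c) \<tau>
      = (\<Sum>v\<in>X - \<tau>. if v = s then face_sign (insert s \<tau>) s * (face_sign (insert s \<tau>) s * c \<tau>) else 0)"
    unfolding aug_boundary_cofaces[OF X(1) \<tau>]
    by (rule sum.cong[OF refl]) (use False in \<open>auto simp: cone_def\<close>)
  also have "\<dots> = c \<tau>" using X False by (simp add: face_sign_square flip: mult.assoc)
  finally show ?thesis using False by (simp add: cone_def)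
qed

lemma boundary_eq_aug_boundary:
  assumes "finite X" "\<And>\<sigma>. c \<sigma> \<noteq> 0 \<Longrightarrow> \<sigma> \<subseteq> X"
  shows "boundary c \<tau> = (if \<tau> = {} then 0 else aug_boundary X c \<tau>)"
proof -
  have "{\<sigma>. c \<sigma> \<noteq> 0} \<subseteq> Pow X" using assms(2) by blast
  with boundary_eq[of "Pow X" c \<tau>] assms(1) show ?thesis by (simp add: aug_boundary_def)
qed

section \<open>The double complex of a relation\<close>

definition dowker_complex :: "'a set \<Rightarrow> 'b set \<Rightarrow> ('a \<Rightarrow> 'b \<Rightarrow> bool) \<Rightarrow> 'a set set" where
  "dowker_complex X Y R = {\<sigma>. \<sigma> \<noteq> {} \<and> \<sigma> \<subseteq> X \<and> (\<exists>y\<in>Y. \<forall>x\<in>\<sigma>. R x y)}"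

text \<open>Bidegrees are cardinalities, so the augmentations sit in \<open>p = 0\<close> and in \<open>q = 0\<close>.\<close>

definition bichains ::
  "'a set \<Rightarrow> 'b set \<Rightarrow> ('a \<Rightarrow> 'b \<Rightarrow> bool) \<Rightarrow> nat \<Rightarrow> nat \<Rightarrow> ('a set \<Rightarrow> 'b set \<Rightarrow> 'k::field) set" where
  "bichains X Y R p q = {f. \<forall>\<sigma> \<tau>. f \<sigma> \<tau> \<noteq> 0 \<longrightarrow> card \<sigma> = p \<and> card \<tau> = q \<and>
     \<sigma> \<in> insert {} (dowker_complex X Y R) \<and> \<tau> \<in> insert {} (dowker_complex Y X (\<lambda>y x. R x y)) \<and>
     (\<forall>x\<in>\<sigma>. \<forall>y\<in>\<tau>. R x y)}"

definition boundary1 :: "'a set \<Rightarrow> ('a set \<Rightarrow> 'b set \<Rightarrow> 'k::field) \<Rightarrow> 'a set \<Rightarrow> 'b set \<Rightarrow> 'k" where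
  "boundary1 X f \<sigma> \<tau> = aug_boundary X (\<lambda>\<rho>. f \<rho> \<tau>) \<sigma>"

definition boundary2 :: "'b set \<Rightarrow> ('a set \<Rightarrow> 'b set \<Rightarrow> 'k::field) \<Rightarrow> 'a set \<Rightarrow> 'b set \<Rightarrow> 'k" where
  "boundary2 Y f \<sigma> \<tau> = aug_boundary Y (f \<sigma>) \<tau>"

lemma dowker_complex_face:
  "\<sigma> \<in> dowker_complex X Y R \<Longrightarrow> \<tau> \<subseteq> \<sigma> \<Longrightarrow> \<tau> \<in> insert {} (dowker_complex X Y R)"
  unfolding dowker_complex_def by blast

lemma simplicial_complex_dowker_complex:
  "finite X \<Longrightarrow> simplicial_complex (dowker_complex X Y R)"
  unfolding simplicial_complex_def dowker_complex_def using finite_subset by blast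

lemma dowker_complex_mono:
  "(\<And>x y. R x y \<Longrightarrow> S x y) \<Longrightarrow> dowker_complex X Y R \<subseteq> dowker_complex X Y S"
  unfolding dowker_complex_def by blast

lemma bichains_card:
  "f \<in> bichains X Y R p q \<Longrightarrow> card \<sigma> \<noteq> p \<or> card \<tau> \<noteq> q \<Longrightarrow> f \<sigma> \<tau> = 0"
  unfolding bichains_def mem_Collect_eq by metis

lemma bichains_subset:
  assumes "f \<in> bichains X Y R p q" "f \<sigma> \<tau> \<noteq> 0"
  shows "\<sigma> \<subseteq> X" "\<tau> \<subseteq> Y"
proof -
  have "\<sigma> \<in> insert {} (dowker_complex X Y R)" "\<tau> \<in> insert {} (dowker_complex Y X (\<lambda>y x. R x y))"
    using assms unfolding bichains_def mem_Collect_eq by metis+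
  then show "\<sigma> \<subseteq> X" "\<tau> \<subseteq> Y" by (auto simp: dowker_complex_def)
qed

lemma bichains_swap:
  "(\<lambda>\<tau> \<sigma>. f \<sigma> \<tau>) \<in> bichains Y X (\<lambda>y x. R x y) q p \<longleftrightarrow> f \<in> bichains X Y R p q"
  unfolding bichains_def by blast

lemma bichains_mono:
  assumes "\<And>x y. R x y \<Longrightarrow> S x y"
  shows "bichains X Y R p q \<subseteq> bichains X Y S p q"
proof -
  have "dowker_complex X Y R \<subseteq> dowker_complex X Y S"
    "dowker_complex Y X (\<lambda>y x. R x y) \<subseteq> dowker_complex Y X (\<lambda>y x. S x y)"
    using assms by (intro dowker_complex_mono; simp)+
  then have "\<sigma> \<in> insert {} (dowker_complex X Y R) \<and> \<tau> \<in> insert {} (dowker_complex Y X (\<lambda>y x. R x y)) \<and>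
      (\<forall>x\<in>\<sigma>. \<forall>y\<in>\<tau>. R x y) \<Longrightarrow>
      \<sigma> \<in> insert {} (dowker_complex X Y S) \<and> \<tau> \<in> insert {} (dowker_complex Y X (\<lambda>y x. S x y)) \<and>
      (\<forall>x\<in>\<sigma>. \<forall>y\<in>\<tau>. S x y)" for \<sigma> \<tau>
    by (auto intro: assms)
  then show ?thesis unfolding bichains_def by (intro Collect_mono) metis
qed

lemma bichains_add:
  "f \<in> bichains X Y R p q \<Longrightarrow> g \<in> bichains X Y R p q \<Longrightarrow> (\<lambda>\<sigma> \<tau>. f \<sigma> \<tau> + g \<sigma> \<tau>) \<in> bichains X Y R p q"
  unfolding bichains_def by (simp, metis add_0)

lemma bichains_diff:
  "f \<in> bichains X Y R p q \<Longrightarrow> g \<in> bichains X Y R p q \<Longrightarrow> (\<lambda>\<sigma> \<tau>. f \<sigma> \<tau> - g \<sigma> \<tau>) \<in> bichains X Y R p q"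
  unfolding bichains_def by (simp, metis diff_self)

lemma bichains_smult:
  "f \<in> bichains X Y R p q \<Longrightarrow> (\<lambda>\<sigma> \<tau>. a * f \<sigma> \<tau>) \<in> bichains X Y R p q"
  unfolding bichains_def mem_Collect_eq by (metis mult_zero_right)

lemma boundary1_bichains:
  assumes fin: "finite X" and f: "f \<in> bichains X Y R (Suc p) q"
  shows "boundary1 X f \<in> bichains X Y R p q"
proof -
  have "card \<sigma> = p \<and> card \<tau> = q \<and> \<sigma> \<in> insert {} (dowker_complex X Y R) \<and>
      \<tau> \<in> insert {} (dowker_complex Y X (\<lambda>y x. R x y)) \<and> (\<forall>x\<in>\<sigma>. \<forall>y\<in>\<tau>. R x y)"
    if nz: "boundary1 X f \<sigma> \<tau> \<noteq> 0" for \<sigma> \<tau>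
  proof -
    from nz obtain \<rho> v where \<rho>: "\<rho> \<subseteq> X" "f \<rho> \<tau> \<noteq> 0" "v \<in> \<rho>" "\<sigma> = \<rho> - {v}"
      unfolding boundary1_def by (rule aug_boundary_nonzero)
    with f have *: "card \<rho> = Suc p" "card \<tau> = q" "\<rho> \<in> dowker_complex X Y R"
      "\<tau> \<in> insert {} (dowker_complex Y X (\<lambda>y x. R x y))" "\<forall>x\<in>\<rho>. \<forall>y\<in>\<tau>. R x y"
      unfolding bichains_def by blast+
    then have "card \<sigma> = p" using \<rho> by simp
    moreover have "\<sigma> \<in> insert {} (dowker_complex X Y R)" by (rule dowker_complex_face[OF *(3)]) (simp add: \<rho>(4) Diff_subset)
    ultimately show ?thesis using * \<rho> by auto
  qed
  then show ?thesis unfolding bichains_def by blast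
qed

lemma boundary2_swap: "boundary2 Y f = (\<lambda>\<sigma> \<tau>. boundary1 Y (\<lambda>\<tau> \<sigma>. f \<sigma> \<tau>) \<tau> \<sigma>)"
  by (simp add: boundary1_def boundary2_def fun_eq_iff)

lemma boundary2_bichains:
  assumes "finite Y" "f \<in> bichains X Y R p (Suc q)"
  shows "boundary2 Y f \<in> bichains X Y R p q"
  using boundary1_bichains[OF assms(1), of "\<lambda>\<tau> \<sigma>. f \<sigma> \<tau>" X "\<lambda>y x. R x y" q p] assms(2)
    bichains_swap[where f = f] bichains_swap[where f = "boundary2 Y f"]
  by (simp add: boundary2_swap)

text \<open>The boundaries act on different arguments, so interchanging the sums suffices. They
  commute rather than anticommute, as neither carries a sign from the other degree.\<close>

lemma boundary1_boundary2: "boundary1 X (boundary2 Y f) = boundary2 Y (boundary1 X f)"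
proof (intro ext)
  fix \<sigma> \<tau>
  have "boundary1 X (boundary2 Y f) \<sigma> \<tau> = (\<Sum>\<rho>\<in>Pow X. \<Sum>\<upsilon>\<in>Pow Y. f \<rho> \<upsilon> * incidence \<upsilon> \<tau> * incidence \<rho> \<sigma>)"
    by (simp add: boundary1_def boundary2_def aug_boundary_def sum_distrib_right)
  also have "\<dots> = (\<Sum>\<upsilon>\<in>Pow Y. \<Sum>\<rho>\<in>Pow X. f \<rho> \<upsilon> * incidence \<rho> \<sigma> * incidence \<upsilon> \<tau>)"
    by (subst sum.swap) (simp add: ac_simps)
  also have "\<dots> = boundary2 Y (boundary1 X f) \<sigma> \<tau>"
    by (simp add: boundary1_def boundary2_def aug_boundary_def sum_distrib_right)
  finally show "boundary1 X (boundary2 Y f) \<sigma> \<tau> = boundary2 Y (boundary1 X f) \<sigma> \<tau>" .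
qed

lemma boundary1_boundary1: "finite X \<Longrightarrow> boundary1 X (boundary1 X f) = (\<lambda>_ _. 0)"
  by (simp add: boundary1_def aug_boundary_aug_boundary fun_eq_iff)

lemma boundary2_boundary2: "finite Y \<Longrightarrow> boundary2 Y (boundary2 Y f) = (\<lambda>_ _. 0)"
  by (simp add: boundary2_def[abs_def] aug_boundary_aug_boundary)

text \<open>In degree \<open>q = 0\<close> only \<open>\<tau> = {}\<close> carries coefficients, and
  it has no faces. Finiteness of \<open>Y\<close> excludes infinite sets, whose \<open>card\<close>
  is 0 as well.\<close>

lemma boundary2_bichains_0:
  assumes "f \<in> bichains X Y R p 0"  "finite Y"
  shows "boundary2 Y f = (\<lambda>_ _. 0)"
proof (rule ccontr)
  assume "boundary2 Y f \<noteq> (\<lambda>_ _. 0)"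
  then obtain \<sigma> \<tau> where "aug_boundary Y (f \<sigma>) \<tau> \<noteq> 0" by (auto simp: boundary2_def fun_eq_iff)
  then obtain \<upsilon> v where "\<upsilon> \<subseteq> Y" "f \<sigma> \<upsilon> \<noteq> 0" "v \<in> \<upsilon>" by (rule aug_boundary_nonzero)
  then show False using assms finite_subset unfolding bichains_def by fastforce
qed

text \<open>Each row is contracted by a cone whose apex is related to all of
  \<open>\<sigma>\<close>; the apex may vary with \<open>\<sigma>\<close> because
  \<open>boundary2\<close> fixes \<open>\<sigma>\<close>. Degree \<open>Suc p\<close> excludes the
  row \<open>\<sigma> = {}\<close>, which is the augmented complex of the other Dowker
  complex.\<close>

lemma row_exact:
  assumes fin: "finite Y" and f: "f \<in> bichains X Y R (Suc p) q" and "boundary2 Y f = (\<lambda>_ _. 0)"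
  obtains g where "g \<in> bichains X Y R (Suc p) (Suc q)" "boundary2 Y g = f"
proof
  define s where "s \<sigma> = (SOME y. y \<in> Y \<and> (\<forall>x\<in>\<sigma>. R x y))" for \<sigma>
  define g where "g \<sigma> = cone (s \<sigma>) (f \<sigma>)" for \<sigma>
  have f': "card \<sigma> = Suc p \<and> card \<tau> = q \<and> \<sigma> \<in> dowker_complex X Y R \<and>
      \<tau> \<in> insert {} (dowker_complex Y X (\<lambda>y x. R x y)) \<and> (\<forall>x\<in>\<sigma>. \<forall>y\<in>\<tau>. R x y)" if "f \<sigma> \<tau> \<noteq> 0" for \<sigma> \<tau>
    using f that unfolding bichains_def by fastforce
  have s: "s \<sigma> \<in> Y \<and> (\<forall>x\<in>\<sigma>. R x (s \<sigma>))" if "f \<sigma> \<tau> \<noteq> 0" for \<sigma> \<tau>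
    unfolding s_def by (rule someI_ex) (use f'[OF that] in \<open>auto simp: dowker_complex_def\<close>)
  have "card \<sigma> = Suc p \<and> card \<tau> = Suc q \<and> \<sigma> \<in> dowker_complex X Y R \<and>
      \<tau> \<in> dowker_complex Y X (\<lambda>y x. R x y) \<and> (\<forall>x\<in>\<sigma>. \<forall>y\<in>\<tau>. R x y)" if "g \<sigma> \<tau> \<noteq> 0" for \<sigma> \<tau>
  proof -
    from that have st: "s \<sigma> \<in> \<tau>" and nz: "f \<sigma> (\<tau> - {s \<sigma>}) \<noteq> 0"
      by (auto simp: g_def cone_def split: if_splits)
    note * = f'[OF nz] s[OF nz]
    have sub: "\<tau> \<subseteq> Y" using * by (auto simp: dowker_complex_def)
    have "\<forall>x\<in>\<sigma>. \<forall>y\<in>\<tau>. R x y" using * by blast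
    \<comment> \<open>Any vertex of the nonempty \<open>\<sigma>\<close> is related to all of
      \<open>\<tau>\<close> and so witnesses that \<open>\<tau>\<close> is a simplex.\<close>
    moreover have "\<sigma> \<noteq> {}" "\<sigma> \<subseteq> X" using * by (auto simp: dowker_complex_def)
    ultimately have "\<tau> \<in> dowker_complex Y X (\<lambda>y x. R x y)"
      using st sub unfolding dowker_complex_def by blast
    moreover have "card \<tau> = Suc q"
      using * st finite_subset[OF sub fin] by (metis card_Suc_Diff1)
    ultimately show ?thesis using * \<open>\<forall>x\<in>\<sigma>. \<forall>y\<in>\<tau>. R x y\<close> by blast
  qed
  then show g: "g \<in> bichains X Y R (Suc p) (Suc q)" unfolding bichains_def by blast
  show "boundary2 Y g = f"
  proof (intro ext)
    fix \<sigma> \<tau>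
    \<comment> \<open>The apex \<open>s \<sigma>\<close> is known to lie in \<open>Y\<close> only if
      the row of \<open>\<sigma>\<close> is nonzero; \<open>\<upsilon>\<close> certifies this. Zero
      rows and sets outside \<open>Y\<close> are treated directly.\<close>
    consider "\<not> \<tau> \<subseteq> Y" | "\<tau> \<subseteq> Y" "\<And>\<tau>. f \<sigma> \<tau> = 0" | \<upsilon> where "\<tau> \<subseteq> Y" "f \<sigma> \<upsilon> \<noteq> 0" by blast
    then show "boundary2 Y g \<sigma> \<tau> = f \<sigma> \<tau>"
    proof cases
      case 1
      then have "f \<sigma> \<tau> = 0" using f'[of \<sigma> \<tau>] by (auto simp: dowker_complex_def)
      moreover have "boundary2 Y g \<sigma> \<tau> = 0"
        unfolding boundary2_def using 1 by (metis Diff_subset aug_boundary_nonzero subset_trans)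
      ultimately show ?thesis by simp
    next
      case 2
      then have "g \<sigma> = (\<lambda>_. 0)" by (simp add: g_def cone_def fun_eq_iff)
      then show ?thesis by (simp add: boundary2_def aug_boundary_zero 2)
    next
      case 3
      have "aug_boundary Y (f \<sigma>) = (\<lambda>_. 0)" using assms(3) by (simp add: boundary2_def fun_eq_iff)
      then show ?thesis
        using cone_contraction[OF fin conjunct1[OF s[OF 3(2)]] 3(1), of "f \<sigma>"]
        by (simp add: boundary2_def g_def cone_def split: if_splits)
    qed
  qed
qed

section \<open>Zigzags\<close>

text \<open>A staircase of total degree \<open>q + n + 2\<close> with ends
  \<open>boundary2 Y (c n)\<close> in bidegree \<open>(n + 1, q)\<close> and
  \<open>boundary1 X (c 0)\<close> in bidegree \<open>(0, q + n + 1)\<close>. Zigzags between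
  \<open>k\<close>-cycles have \<open>n = k\<close> and \<open>q = 0\<close>; general
  \<open>q\<close> serves induction, as dropping the last entry raises \<open>q\<close> by
  one.\<close>

definition zigzags ::
  "'a set \<Rightarrow> 'b set \<Rightarrow> ('a \<Rightarrow> 'b \<Rightarrow> bool) \<Rightarrow> nat \<Rightarrow> nat \<Rightarrow> (nat \<Rightarrow> 'a set \<Rightarrow> 'b set \<Rightarrow> 'k::field) set" where
  "zigzags X Y R n q = {c. (\<forall>i\<le>n. c i \<in> bichains X Y R (Suc i) (Suc (q + n - i))) \<and>
     (\<forall>i<n. boundary1 X (c (Suc i)) = boundary2 Y (c i))}"

text \<open>Lift \<open>f\<close> to \<open>g\<close> by row exactness. As the boundaries commute
  and \<open>boundary1 X f\<close> vanishes, \<open>boundary2\<close> kills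
  \<open>boundary1 X g\<close>, and the descent continues from there. For \<open>n = 0\<close> one
  lift suffices, so \<open>f\<close> may have nonzero augmentation, as befits unreduced
  homology.\<close>

lemma zigzag_exists:
  assumes "finite X" "finite Y"
  shows "f \<in> bichains X Y R (Suc n) q \<Longrightarrow> boundary2 Y f = (\<lambda>_ _. 0) \<Longrightarrow>
    n = 0 \<or> boundary1 X f = (\<lambda>_ _. 0) \<Longrightarrow> \<exists>c\<in>zigzags X Y R n q. boundary2 Y (c n) = f"
proof (induction n arbitrary: f q)
  case 0
  from row_exact[OF assms(2) 0(1,2)] obtain g where "g \<in> bichains X Y R (Suc 0) (Suc q)" "boundary2 Y g = f" .
  then show ?case by (intro bexI[of _ "\<lambda>_. g"]) (auto simp: zigzags_def)
next
  case (Suc m)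
  from row_exact[OF assms(2) Suc.prems(1,2)] obtain g where
    g: "g \<in> bichains X Y R (Suc (Suc m)) (Suc q)" "boundary2 Y g = f" .
  have "boundary2 Y (boundary1 X g) = (\<lambda>_ _. 0)"
    using Suc.prems(3) g(2) by (simp flip: boundary1_boundary2)
  from Suc.IH[OF boundary1_bichains[OF assms(1) g(1)] this] obtain c where
    c: "c \<in> zigzags X Y R m (Suc q)" "boundary2 Y (c m) = boundary1 X g"
    by (auto simp: boundary1_boundary1[OF assms(1)])
  have "c(Suc m := g) \<in> zigzags X Y R (Suc m) q"
    using c g(1) by (auto simp: zigzags_def le_Suc_eq less_Suc_eq)
  then show ?case using g(2) by (intro bexI[of _ "c(Suc m := g)"]) simp_all
qed

text \<open>One step of the diagram chase: lift \<open>b\<close> to \<open>e'\<close>, correct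
  \<open>f\<close> by \<open>boundary1 X e'\<close> to get into the kernel of
  \<open>boundary2\<close>, and lift the result to \<open>e\<close>. The correction disappears under
  \<open>boundary1\<close>.\<close>

lemma boundary_lift:
  assumes fin: "finite X" "finite Y"
    and f: "f \<in> bichains X Y R (Suc p) (Suc q)"
    and b: "b \<in> bichains X Y R (Suc (Suc p)) q" "boundary2 Y b = (\<lambda>_ _. 0)"
    and fb: "boundary2 Y f = boundary1 X b"
  obtains e where "e \<in> bichains X Y R (Suc p) (Suc (Suc q))" "boundary1 X f = boundary1 X (boundary2 Y e)"
proof -
  from row_exact[OF fin(2) b] obtain e' where
    e': "e' \<in> bichains X Y R (Suc (Suc p)) (Suc q)" "boundary2 Y e' = b" .
  let ?f = "\<lambda>\<sigma> \<tau>. f \<sigma> \<tau> - boundary1 X e' \<sigma> \<tau>"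
  have "?f \<in> bichains X Y R (Suc p) (Suc q)"
    by (intro bichains_diff boundary1_bichains[OF fin(1) e'(1)] f)
  moreover have "boundary2 Y (boundary1 X e') = boundary2 Y f"
    by (simp add: fb e'(2) flip: boundary1_boundary2)
  then have "boundary2 Y ?f = (\<lambda>_ _. 0)"
    by (simp add: boundary2_def aug_boundary_diff fun_eq_iff)
  ultimately obtain e where e: "e \<in> bichains X Y R (Suc p) (Suc (Suc q))" "boundary2 Y e = ?f"
    by (rule row_exact[OF fin(2)])
  have "boundary1 X (boundary2 Y e) = boundary1 X f"
    using boundary1_boundary1[OF fin(1), of e'] unfolding e(2)
    by (simp add: boundary1_def aug_boundary_diff fun_eq_iff)
  with e(1) that show thesis by simp
qed

text \<open>If one end bounds, \<open>boundary_lift\<close> carries the bounding bichain along the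
  staircase to the other end.\<close>

lemma zigzag_boundary:
  assumes "finite X" "finite Y"
  shows "c \<in> zigzags X Y R n q \<Longrightarrow> b \<in> bichains X Y R (Suc (Suc n)) q \<Longrightarrow> boundary2 Y b = (\<lambda>_ _. 0) \<Longrightarrow>
    boundary2 Y (c n) = boundary1 X b \<Longrightarrow>
    \<exists>e\<in>bichains X Y R (Suc 0) (Suc (Suc (q + n))). boundary1 X (c 0) = boundary1 X (boundary2 Y e)"
proof (induction n arbitrary: b q)
  case 0
  have "c 0 \<in> bichains X Y R (Suc 0) (Suc q)" using 0(1) by (auto simp: zigzags_def)
  from boundary_lift[OF assms this 0(2-4)] show ?case by auto
next
  case (Suc m)
  have "c (Suc m) \<in> bichains X Y R (Suc (Suc m)) (Suc q)" using Suc.prems(1) by (auto simp: zigzags_def)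
  from boundary_lift[OF assms this Suc.prems(2-4)] obtain e where
    e: "e \<in> bichains X Y R (Suc (Suc m)) (Suc (Suc q))" "boundary1 X (c (Suc m)) = boundary1 X (boundary2 Y e)" .
  have "c \<in> zigzags X Y R m (Suc q)" "boundary2 Y (c m) = boundary1 X (c (Suc m))"
    using Suc.prems(1) by (auto simp: zigzags_def)
  \<comment> \<open>For the shortened zigzag, \<open>boundary2 Y e\<close> takes over the role of
    \<open>b\<close>.\<close>
  then show ?case
    using Suc.IH[of "Suc q" "boundary2 Y e"] boundary2_bichains[OF assms(2) e(1)] e(2)
    by (simp add: boundary2_boundary2[OF assms(2)])
qed

section \<open>The correspondence of cycles given by the ends of zigzags\<close>

definition source_cycle :: "nat \<Rightarrow> 'b set \<Rightarrow> (nat \<Rightarrow> 'a set \<Rightarrow> 'b set \<Rightarrow> 'k::field) \<Rightarrow> 'a set \<Rightarrow> 'k" where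
  "source_cycle k Y c \<sigma> = boundary2 Y (c k) \<sigma> {}"

definition target_cycle :: "'a set \<Rightarrow> (nat \<Rightarrow> 'a set \<Rightarrow> 'b set \<Rightarrow> 'k::field) \<Rightarrow> 'b set \<Rightarrow> 'k" where
  "target_cycle X c \<tau> = boundary1 X (c 0) {} \<tau>"

text \<open>A linear relation rather than a map, since lifts along a zigzag are not unique. Avoiding
  choices makes symmetry and naturality immediate; on homology classes the relation becomes a
  bijection.\<close>

definition dowker_corr ::
  "'a set \<Rightarrow> 'b set \<Rightarrow> ('a \<Rightarrow> 'b \<Rightarrow> bool) \<Rightarrow> nat \<Rightarrow> (('a set \<Rightarrow> 'k::field) \<times> ('b set \<Rightarrow> 'k)) set" where
  "dowker_corr X Y R k = (\<lambda>c. (source_cycle k Y c, target_cycle X c)) ` zigzags X Y R k 0"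

text \<open>Reading a zigzag backwards with arguments transposed exchanges \<open>X\<close> and
  \<open>Y\<close>, so every result on sources has a mirror image for targets.\<close>

lemma zigzags_reverse:
  assumes "c \<in> zigzags X Y R k 0"
  shows "(\<lambda>i \<tau> \<sigma>. c (k - i) \<sigma> \<tau>) \<in> zigzags Y X (\<lambda>y x. R x y) k 0"
proof -
  have "(\<lambda>\<tau> \<sigma>. c (k - i) \<sigma> \<tau>) \<in> bichains Y X (\<lambda>y x. R x y) (Suc i) (Suc (k - i))" if "i \<le> k" for i
  proof -
    have "k - (k - i) = i" using that by simp
    then have "c (k - i) \<in> bichains X Y R (Suc (k - i)) (Suc i)"
      using assms unfolding zigzags_def by (metis (mono_tags, lifting) add_0 diff_le_self mem_Collect_eq)
    then show ?thesis by (rule iffD2[OF bichains_swap])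
  qed
  moreover have "boundary1 Y (\<lambda>\<tau> \<sigma>. c (k - Suc i) \<sigma> \<tau>) = boundary2 X (\<lambda>\<tau> \<sigma>. c (k - i) \<sigma> \<tau>)" if "i < k" for i
  proof -
    have "boundary1 X (c (Suc (k - Suc i))) = boundary2 Y (c (k - Suc i))"
      using assms that by (simp add: zigzags_def)
    then show ?thesis
      using that by (simp add: Suc_diff_Suc boundary1_def boundary2_def fun_eq_iff)
  qed
  ultimately show ?thesis by (simp add: zigzags_def)
qed

lemma dowker_corr_converse_subset:
  "(dowker_corr X Y R k :: (('a set \<Rightarrow> 'k::field) \<times> ('b set \<Rightarrow> 'k)) set)\<inverse> \<subseteq> dowker_corr Y X (\<lambda>y x. R x y) k"
proof -
  have "(target_cycle X c, source_cycle k Y c) \<in> dowker_corr Y X (\<lambda>y x. R x y) k"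
    if "c \<in> zigzags X Y R k 0" for c :: "nat \<Rightarrow> 'a set \<Rightarrow> 'b set \<Rightarrow> 'k"
    unfolding dowker_corr_def
    by (rule image_eqI[OF _ zigzags_reverse[OF that]])
      (simp add: source_cycle_def target_cycle_def boundary1_def boundary2_def fun_eq_iff)
  then show ?thesis by (auto simp: dowker_corr_def)
qed

lemma dowker_corr_converse: "(dowker_corr X Y R k)\<inverse> = dowker_corr Y X (\<lambda>y x. R x y) k"
  using dowker_corr_converse_subset[of X Y R k] dowker_corr_converse_subset[of Y X "\<lambda>y x. R x y" k] by auto

lemma dowker_corr_swap: "(z, w) \<in> dowker_corr X Y R k \<longleftrightarrow> (w, z) \<in> dowker_corr Y X (\<lambda>y x. R x y) k"
  unfolding dowker_corr_converse[of X Y R k, symmetric] by simp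

text \<open>The boundaries do not mention the relation and bichains for \<open>R\<close> are
  bichains for \<open>S\<close>; naturality of the isomorphism rests on this.\<close>

lemma dowker_corr_mono:
  assumes "\<And>x y. R x y \<Longrightarrow> S x y"
  shows "dowker_corr X Y R k \<subseteq> dowker_corr X Y S k"
  using bichains_mono[of R S, OF assms] unfolding dowker_corr_def zigzags_def by blast

lemma dowker_corr_add:
  assumes "(z, w) \<in> dowker_corr X Y R k" "(z', w') \<in> dowker_corr X Y R k"
  shows "(\<lambda>\<sigma>. z \<sigma> + z' \<sigma>, \<lambda>\<tau>. w \<tau> + w' \<tau>) \<in> dowker_corr X Y R k"
proof -
  from assms obtain c c' where c: "c \<in> zigzags X Y R k 0" "c' \<in> zigzags X Y R k 0"
    "z = source_cycle k Y c" "z' = source_cycle k Y c'" "w = target_cycle X c" "w' = target_cycle X c'"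
    by (auto simp: dowker_corr_def)
  have "(\<lambda>i \<sigma> \<tau>. c i \<sigma> \<tau> + c' i \<sigma> \<tau>) \<in> zigzags X Y R k 0"
    using c(1,2) by (auto simp: zigzags_def bichains_add boundary1_def boundary2_def aug_boundary_add fun_eq_iff)
  then show ?thesis unfolding dowker_corr_def
    by (rule image_eqI[rotated])
      (simp add: c(3-) source_cycle_def target_cycle_def boundary1_def boundary2_def aug_boundary_add fun_eq_iff)
qed

lemma dowker_corr_smult:
  assumes "(z, w) \<in> dowker_corr X Y R k"
  shows "(\<lambda>\<sigma>. a * z \<sigma>, \<lambda>\<tau>. a * w \<tau>) \<in> dowker_corr X Y R k"
proof -
  from assms obtain c where c: "c \<in> zigzags X Y R k 0" "z = source_cycle k Y c" "w = target_cycle X c"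
    by (auto simp: dowker_corr_def)
  have "(\<lambda>i \<sigma> \<tau>. a * c i \<sigma> \<tau>) \<in> zigzags X Y R k 0"
    using c(1) by (auto simp: zigzags_def bichains_smult boundary1_def boundary2_def aug_boundary_smult fun_eq_iff)
  then show ?thesis unfolding dowker_corr_def
    by (rule image_eqI[rotated])
      (simp add: c(2-) source_cycle_def target_cycle_def boundary1_def boundary2_def aug_boundary_smult fun_eq_iff)
qed

text \<open>Over \<open>\<tau> = {}\<close> the rectangle condition is void, leaving membership of
  \<open>\<sigma>\<close> in the complex. A \<open>k\<close>-simplex has \<open>k + 1\<close>
  vertices, hence degree \<open>Suc k\<close>.\<close>

lemma simplicial_chains_bichains:
  assumes "finite X"
  shows "c \<in> simplicial_chains k (dowker_complex X Y R) \<longleftrightarrow>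
    (\<lambda>\<sigma> \<tau>. if \<tau> = {} then c \<sigma> else 0) \<in> bichains X Y R (Suc k) 0"
proof -
  have sub: "dowker_complex X Y R \<subseteq> Pow X" by (auto simp: dowker_complex_def)
  have "finite {\<sigma>. c \<sigma> \<noteq> 0}" if "{\<sigma>. c \<sigma> \<noteq> 0} \<subseteq> {\<sigma> \<in> dowker_complex X Y R. card \<sigma> = k + 1}"
    by (rule finite_subset[of _ "Pow X"]) (use assms that sub in auto)
  then have "c \<in> simplicial_chains k (dowker_complex X Y R) \<longleftrightarrow>
      {\<sigma>. c \<sigma> \<noteq> 0} \<subseteq> {\<sigma> \<in> dowker_complex X Y R. card \<sigma> = k + 1}"
    by (auto simp: simplicial_chains_def)
  also have "\<dots> \<longleftrightarrow> (\<lambda>\<sigma> \<tau>. if \<tau> = {} then c \<sigma> else 0) \<in> bichains X Y R (Suc k) 0"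
  proof -
    have "{} \<notin> dowker_complex X Y R" by (simp add: dowker_complex_def)
    then show ?thesis by (auto simp: bichains_def)
  qed
  finally show ?thesis .
qed

lemma boundary_chain_eq:
  assumes "finite X" "c \<in> simplicial_chains k (dowker_complex X Y R)"
  shows "boundary c \<tau> = (if \<tau> = {} then 0 else aug_boundary X c \<tau>)"
  using assms by (intro boundary_eq_aug_boundary) (auto simp: simplicial_chains_def dowker_complex_def)

lemma bichains_0_eq:
  assumes "f \<in> bichains X Y R p 0" "finite Y"
  shows "f = (\<lambda>\<sigma> \<tau>. if \<tau> = {} then f \<sigma> {} else 0)"
proof (intro ext)
  fix \<sigma> \<tau>
  have "\<tau> = {}" if "f \<sigma> \<tau> \<noteq> 0"
  proof -
    have "card \<tau> = 0" using that bichains_card[OF assms(1)] by blast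
    moreover have "finite \<tau>" using that assms by (intro finite_subset[of \<tau> Y]) (metis bichains_subset)
    ultimately show ?thesis by simp
  qed
  then show "f \<sigma> \<tau> = (if \<tau> = {} then f \<sigma> {} else 0)" by auto
qed

section \<open>Cycles and boundaries at the ends of zigzags\<close>

context
  fixes X :: "'a set" and Y :: "'b set" and R :: "'a \<Rightarrow> 'b \<Rightarrow> bool" and k :: nat
  assumes fin: "finite X" "finite Y"
begin

lemma boundary2_zigzag:
  assumes "c \<in> zigzags X Y R k 0"
  shows "boundary2 Y (c k) \<in> bichains X Y R (Suc k) 0"
    and "boundary2 Y (c k) = (\<lambda>\<sigma> \<tau>. if \<tau> = {} then source_cycle k Y c \<sigma> else 0)"
proof -
  have "c k \<in> bichains X Y R (Suc k) (Suc 0)" using assms by (auto simp: zigzags_def)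
  then show *: "boundary2 Y (c k) \<in> bichains X Y R (Suc k) 0" by (rule boundary2_bichains[OF fin(2)])
  show "boundary2 Y (c k) = (\<lambda>\<sigma> \<tau>. if \<tau> = {} then source_cycle k Y c \<sigma> else 0)"
    unfolding source_cycle_def by (rule bichains_0_eq[OF * fin(2)])
qed

text \<open>For \<open>k > 0\<close>, commuting the boundaries and moving one step down the zigzag
  produces a double \<open>boundary2\<close>, which vanishes.\<close>

lemma source_cycle_cycles:
  assumes "c \<in> zigzags X Y R k 0"
  shows "source_cycle k Y c \<in> cycles k (dowker_complex X Y R)"
proof -
  let ?z = "source_cycle k Y c"
  have z: "?z \<in> simplicial_chains k (dowker_complex X Y R)"
    using boundary2_zigzag[OF assms] by (simp add: simplicial_chains_bichains[OF fin(1)])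
  have "boundary ?z \<sigma> = 0" for \<sigma>
  proof (cases k)
    \<comment> \<open>There is no previous entry here; the only faces of points are empty, and
      \<open>boundary\<close> ignores those.\<close>
    case 0
    show ?thesis
    proof (rule ccontr)
      assume "boundary ?z \<sigma> \<noteq> 0"
      then obtain \<rho> v where "?z \<rho> \<noteq> 0" "v \<in> \<rho>" "\<sigma> = \<rho> - {v}" "\<sigma> \<noteq> {}" by (rule boundary_nonzero)
      moreover from this z have "card \<rho> = 1" by (auto simp: simplicial_chains_def 0)
      ultimately show False by (auto simp: card_1_singleton_iff)
    qed
  next
    case (Suc m)
    have "boundary1 X (boundary2 Y (c k)) = boundary2 Y (boundary1 X (c (Suc m)))"
      by (simp add: Suc boundary1_boundary2)
    also have "boundary1 X (c (Suc m)) = boundary2 Y (c m)" using assms Suc by (simp add: zigzags_def)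
    finally have "boundary1 X (boundary2 Y (c k)) \<sigma> {} = 0" by (simp add: boundary2_boundary2[OF fin(2)])
    then have "aug_boundary X ?z \<sigma> = 0" by (simp add: boundary1_def source_cycle_def[abs_def])
    then show ?thesis by (simp add: boundary_chain_eq[OF fin(1) z])
  qed
  with z show ?thesis by (simp add: cycles_def fun_eq_iff)
qed

text \<open>Placed over \<open>\<tau> = {}\<close>, a cycle is killed by \<open>boundary2\<close>,
  so a zigzag starts from it.\<close>

lemma dowker_corr_total:
  assumes "z \<in> cycles k (dowker_complex X Y R)"
  shows "\<exists>w. (z, w) \<in> dowker_corr X Y R k"
proof -
  let ?f = "\<lambda>\<sigma> (\<tau> :: 'b set). if \<tau> = {} then z \<sigma> else 0"
  have z: "z \<in> simplicial_chains k (dowker_complex X Y R)" "boundary z = (\<lambda>_. 0)"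
    using assms by (auto simp: cycles_def)
  then have f: "?f \<in> bichains X Y R (Suc k) 0" by (simp add: simplicial_chains_bichains[OF fin(1)])
  \<comment> \<open>At nonempty \<open>\<sigma>\<close> this is the cycle condition; at
    \<open>\<sigma> = {}\<close> it holds by degree once \<open>k > 0\<close>, while for
    \<open>k = 0\<close> the augmentation of \<open>z\<close> may be nonzero.\<close>
  have "k = 0 \<or> boundary1 X ?f = (\<lambda>_ _. 0)"
  proof (cases k)
    case (Suc m)
    have "boundary1 X ?f \<sigma> \<tau> = 0" for \<sigma> \<tau>
    proof (cases "\<sigma> = {} \<or> \<tau> \<noteq> {}")
      case True
      then show ?thesis
      proof
        assume "\<sigma> = {}"
        then show ?thesis
          using bichains_card[OF boundary1_bichains[OF fin(1) f], of \<sigma> \<tau>] by (simp add: Suc)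
      next
        assume "\<tau> \<noteq> {}"
        then show ?thesis by (simp add: boundary1_def aug_boundary_zero)
      qed
    next
      case False
      then show ?thesis using boundary_chain_eq[OF fin(1) z(1), of \<sigma>] z(2) by (simp add: boundary1_def)
    qed
    then show ?thesis by blast
  qed simp
  from zigzag_exists[OF fin f boundary2_bichains_0[OF f fin(2)] this]
  obtain c where "c \<in> zigzags X Y R k 0" "boundary2 Y (c k) = ?f" by blast
  then show ?thesis by (intro exI[of _ "target_cycle X c"])
    (auto simp: dowker_corr_def source_cycle_def fun_eq_iff intro!: image_eqI[of _ _ c])
qed

lemma dowker_corr_cycles:
  "(z, w) \<in> dowker_corr X Y R k \<Longrightarrow> z \<in> cycles k (dowker_complex X Y R)"
  using source_cycle_cycles by (auto simp: dowker_corr_def)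

text \<open>Placing a bounding chain of \<open>z\<close> over \<open>\<tau> = {}\<close> and moving
  it along the zigzag yields \<open>e\<close>; commuting the two boundaries shows that
  \<open>w\<close> bounds \<open>boundary1 X e {}\<close>.\<close>

lemma dowker_corr_boundaries:
  assumes "(z, w) \<in> dowker_corr X Y R k" "z \<in> boundaries k (dowker_complex X Y R)"
  shows "w \<in> boundaries k (dowker_complex Y X (\<lambda>y x. R x y))"
proof -
  let ?L = "dowker_complex Y X (\<lambda>y x. R x y)"
  from assms(1) obtain c where c: "c \<in> zigzags X Y R k 0" "z = source_cycle k Y c" "w = target_cycle X c"
    by (auto simp: dowker_corr_def)
  from assms(2) obtain b where b: "b \<in> simplicial_chains (Suc k) (dowker_complex X Y R)" "z = boundary b"
    by (auto simp: boundaries_def)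
  let ?b = "\<lambda>\<sigma> (\<tau> :: 'b set). if \<tau> = {} then b \<sigma> else 0"
  have b': "?b \<in> bichains X Y R (Suc (Suc k)) 0" using b(1) by (simp add: simplicial_chains_bichains[OF fin(1)])
  \<comment> \<open>\<open>boundary\<close> and \<open>aug_boundary\<close> agree except at the
    empty face, where both sides vanish by degree.\<close>
  have "boundary2 Y (c k) \<sigma> \<tau> = boundary1 X ?b \<sigma> \<tau>" for \<sigma> \<tau>
  proof (cases "\<sigma> = {}")
    case True
    then have "boundary2 Y (c k) \<sigma> \<tau> = 0" "boundary1 X ?b \<sigma> \<tau> = 0"
      by (auto intro!: bichains_card[OF boundary2_zigzag(1)[OF c(1)]] bichains_card[OF boundary1_bichains[OF fin(1) b']])
    then show ?thesis by simp
  next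
    case False
    then show ?thesis using boundary_chain_eq[OF fin(1) b(1), of \<sigma>] c(2) b(2)
      by (auto simp: boundary2_zigzag(2)[OF c(1)] boundary1_def aug_boundary_zero)
  qed
  then have "boundary2 Y (c k) = boundary1 X ?b" by blast
  from zigzag_boundary[OF fin c(1) b' boundary2_bichains_0[OF b' fin(2)] this]
  obtain e where e: "e \<in> bichains X Y R (Suc 0) (Suc (Suc k))" "boundary1 X (c 0) = boundary1 X (boundary2 Y e)"
    by auto
  let ?a = "boundary1 X e {}"
  have "boundary1 X e \<in> bichains X Y R 0 (Suc (Suc k))" by (rule boundary1_bichains[OF fin(1) e(1)])
  then have a: "?a \<in> simplicial_chains (Suc k) ?L"
    unfolding simplicial_chains_bichains[OF fin(2)] by (auto simp: bichains_def)
  have "c 0 \<in> bichains X Y R (Suc 0) (Suc k)" using c(1) by (auto simp: zigzags_def)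
  \<comment> \<open>\<open>boundary ?a\<close> is 0 at \<open>{}\<close> by definition, so
    \<open>w\<close> must vanish there too; it does, having degree \<open>Suc k\<close>.\<close>
  from bichains_card[OF boundary1_bichains[OF fin(1) this], of "{}" "{}"]
  have "w {} = 0" by (simp add: c(3) target_cycle_def)
  moreover have "w \<tau> = aug_boundary Y ?a \<tau>" for \<tau>
    by (simp add: c(3) target_cycle_def e(2) boundary1_boundary2) (simp add: boundary2_def)
  ultimately have "w = boundary ?a" by (auto simp: boundary_chain_eq[OF fin(2) a])
  with a show ?thesis by (auto simp: boundaries_def)
qed

end

section \<open>The isomorphism on homology\<close>

context
  fixes X :: "'a set" and Y :: "'b set" and R :: "'a \<Rightarrow> 'b \<Rightarrow> bool" and k :: nat
  assumes fin: "finite X" "finite Y"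
begin

lemma dowker_corr_cycles2:
  "(z, w) \<in> dowker_corr X Y R k \<Longrightarrow> w \<in> cycles k (dowker_complex Y X (\<lambda>y x. R x y))"
  by (rule dowker_corr_cycles[OF fin(2,1) iffD1[OF dowker_corr_swap]])

text \<open>By linearity the partners of elements of one class differ by partners of boundaries,
  which are boundaries. Conversely, any change of \<open>w\<close> by a boundary is matched by a
  change of \<open>z\<close>.\<close>

lemma dowker_corr_class:
  assumes zw: "(z, w) \<in> dowker_corr X Y R k"
  defines "K \<equiv> dowker_complex X Y R" and "L \<equiv> dowker_complex Y X (\<lambda>y x. R x y)"
  shows "dowker_corr X Y R k `` (boundaries k K +>\<^bsub>cycle_space k K\<^esub> z) = boundaries k L +>\<^bsub>cycle_space k L\<^esub> w"
proof -
  have K: "simplicial_complex K" and L: "simplicial_complex L"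
    unfolding K_def L_def using fin by (simp_all add: simplicial_complex_dowker_complex)
  have diff: "(\<lambda>\<sigma>. z1 \<sigma> - z2 \<sigma>, \<lambda>\<tau>. w1 \<tau> - w2 \<tau>) \<in> dowker_corr X Y R k"
    if "(z1, w1) \<in> dowker_corr X Y R k" "(z2, w2) \<in> dowker_corr X Y R k" for z1 z2 w1 w2
    using dowker_corr_add[OF that(1) dowker_corr_smult[OF that(2), of "-1"]] by simp
  show ?thesis
  proof (intro equalityI subsetI)
    fix w' assume "w' \<in> dowker_corr X Y R k `` (boundaries k K +>\<^bsub>cycle_space k K\<^esub> z)"
    then obtain z' where z': "(z', w') \<in> dowker_corr X Y R k" "(\<lambda>\<sigma>. z' \<sigma> - z \<sigma>) \<in> boundaries k K"
      by (auto simp: mem_homology_class[OF K])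
    from dowker_corr_boundaries[OF fin diff[OF z'(1) zw]] z'(2)
    have "(\<lambda>\<tau>. w' \<tau> - w \<tau>) \<in> boundaries k L" by (simp add: K_def L_def)
    then show "w' \<in> boundaries k L +>\<^bsub>cycle_space k L\<^esub> w" by (simp add: mem_homology_class[OF L])
  next
    fix w' assume "w' \<in> boundaries k L +>\<^bsub>cycle_space k L\<^esub> w"
    then have b: "(\<lambda>\<tau>. w' \<tau> - w \<tau>) \<in> boundaries k L" by (simp add: mem_homology_class[OF L])
    \<comment> \<open>As a cycle, the difference has a partner \<open>a\<close> by totality of the
      mirrored correspondence, and \<open>a\<close> bounds because the difference does.\<close>
    then have "(\<lambda>\<tau>. w' \<tau> - w \<tau>) \<in> cycles k L" using boundaries_cycles[OF L] by blast
    from dowker_corr_total[OF fin(2,1) this[unfolded L_def]]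
    obtain a where a': "(\<lambda>\<tau>. w' \<tau> - w \<tau>, a) \<in> dowker_corr Y X (\<lambda>y x. R x y) k" by blast
    then have a: "(a, \<lambda>\<tau>. w' \<tau> - w \<tau>) \<in> dowker_corr X Y R k" by (rule iffD2[OF dowker_corr_swap])
    have "a \<in> boundaries k K"
      using dowker_corr_boundaries[OF fin(2,1) a'] b by (simp add: K_def L_def)
    then have "(\<lambda>\<sigma>. z \<sigma> + a \<sigma>) \<in> boundaries k K +>\<^bsub>cycle_space k K\<^esub> z"
      by (simp add: mem_homology_class[OF K])
    moreover have "(\<lambda>\<sigma>. z \<sigma> + a \<sigma>, w') \<in> dowker_corr X Y R k"
      using dowker_corr_add[OF zw a] by simp
    ultimately show "w' \<in> dowker_corr X Y R k `` (boundaries k K +>\<^bsub>cycle_space k K\<^esub> z)" by blast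
  qed
qed

lemma homology_dowker_cases:
  assumes "C \<in> carrier (homology k (dowker_complex X Y R))"
  obtains z w where "(z, w) \<in> dowker_corr X Y R k"
    "C = boundaries k (dowker_complex X Y R) +>\<^bsub>cycle_space k (dowker_complex X Y R)\<^esub> z"
  proof -
  from assms obtain z where z: "z \<in> cycles k (dowker_complex X Y R)"
    "C = boundaries k (dowker_complex X Y R) +>\<^bsub>cycle_space k (dowker_complex X Y R)\<^esub> z"
    by (auto simp: carrier_homology)
  with dowker_corr_total[OF fin z(1)] that show thesis by auto
qed

end

text \<open>Linearity is checked on corresponding pairs of representatives, which can be added and
  scaled; the inverse is the image under the converse relation.\<close>

lemma dowker_duality:
  fixes R :: "'a \<Rightarrow> 'b \<Rightarrow> bool"
  assumes fin: "finite X" "finite Y"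
  defines "K \<equiv> dowker_complex X Y R" and "L \<equiv> dowker_complex Y X (\<lambda>y x. R x y)"
  shows "linear_map (class_ring :: 'k::field ring) (homology k K) (homology k L) (Image (dowker_corr X Y R k))"
    and "bij_betw (Image (dowker_corr X Y R k)) (carrier (homology k K :: ('k, _) module)) (carrier (homology k L))"
proof -
  let ?Z = "dowker_corr X Y R k :: (('a set \<Rightarrow> 'k) \<times> ('b set \<Rightarrow> 'k)) set"
  have K: "simplicial_complex K" and L: "simplicial_complex L"
    unfolding K_def L_def using fin by (simp_all add: simplicial_complex_dowker_complex)
  note cls = dowker_corr_class[OF fin, of _ _ R k, folded K_def L_def]
  note cases' = homology_dowker_cases[OF fin, of _ k R, folded K_def]
  have carrier: "?Z `` C \<in> carrier (homology k L)" if "C \<in> carrier (homology k K)" for C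
    using that by (rule cases')
      (use dowker_corr_cycles2[OF fin, of _ _ R k] in \<open>auto simp: cls carrier_homology simp flip: L_def\<close>)
  have "?Z `` (C \<oplus>\<^bsub>homology k K\<^esub> D) = ?Z `` C \<oplus>\<^bsub>homology k L\<^esub> ?Z `` D"
    if C: "C \<in> carrier (homology k K)" and D: "D \<in> carrier (homology k K)" for C D
  proof -
    obtain z w where z: "(z, w) \<in> ?Z" "C = boundaries k K +>\<^bsub>cycle_space k K\<^esub> z" using C by (rule cases')
    obtain z' w' where z': "(z', w') \<in> ?Z" "D = boundaries k K +>\<^bsub>cycle_space k K\<^esub> z'" using D by (rule cases')
    show ?thesis
      by (simp add: z(2) z'(2) homology_add[OF K] cls[OF z(1)] cls[OF z'(1)] homology_add[OF L]
          cls[OF dowker_corr_add[OF z(1) z'(1)]])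
  qed
  moreover have "?Z `` (a \<odot>\<^bsub>homology k K\<^esub> C) = a \<odot>\<^bsub>homology k L\<^esub> ?Z `` C"
    if C: "C \<in> carrier (homology k K)" for a C
  proof -
    obtain z w where z: "(z, w) \<in> ?Z" "C = boundaries k K +>\<^bsub>cycle_space k K\<^esub> z" using C by (rule cases')
    show ?thesis
      by (simp add: z(2) homology_smult[OF K] cls[OF z(1)] homology_smult[OF L] cls[OF dowker_corr_smult[OF z(1)]])
  qed
  ultimately have "Image ?Z \<in> LinearCombinations.module_hom class_ring (homology k K) (homology k L)"
    using carrier by (auto simp: LinearCombinations.module_hom_def)
  then show "linear_map (class_ring :: 'k ring) (homology k K) (homology k L) (Image ?Z)"
    using vectorspace_homology[OF K, of k, where 'k = 'k] vectorspace_homology[OF L, of k, where 'k = 'k]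
    by (simp add: linear_map_def mod_hom_def mod_hom_axioms_def vectorspace_def)
  \<comment> \<open>The converse is the correspondence of the transposed relation, so
    \<open>dowker_corr_class\<close> computes its images of classes as well.\<close>
  have cls': "?Z\<inverse> `` (boundaries k L +>\<^bsub>cycle_space k L\<^esub> w) = boundaries k K +>\<^bsub>cycle_space k K\<^esub> z"
    if "(z, w) \<in> ?Z" for z w
    using dowker_corr_class[OF fin(2,1) iffD1[OF dowker_corr_swap that]]
    by (simp add: dowker_corr_converse[of X Y R k] K_def L_def)
  have cases'': thesis if D: "D \<in> carrier (homology k L)"
    and hyp: "\<And>z w. (z, w) \<in> ?Z \<Longrightarrow> D = boundaries k L +>\<^bsub>cycle_space k L\<^esub> w \<Longrightarrow> thesis" for D thesis
  proof -
    obtain w z where "(w, z) \<in> dowker_corr Y X (\<lambda>y x. R x y) k" "D = boundaries k L +>\<^bsub>cycle_space k L\<^esub> w"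
      using homology_dowker_cases[OF fin(2,1) D[unfolded L_def]] unfolding L_def by blast
    then show thesis using hyp[OF iffD2[OF dowker_corr_swap]] by blast
  qed
  have "?Z\<inverse> `` (?Z `` C) = C" if "C \<in> carrier (homology k K)" for C
    using that by (rule cases') (simp add: cls cls')
  moreover have "?Z `` (?Z\<inverse> `` D) = D" if "D \<in> carrier (homology k L)" for D
    using that by (rule cases'') (simp add: cls cls')
  moreover have "?Z\<inverse> `` D \<in> carrier (homology k K)" if "D \<in> carrier (homology k L)" for D
    using that by (rule cases'')
      (use dowker_corr_cycles[OF fin, of _ _ R k] in \<open>auto simp: cls' carrier_homology K_def\<close>)
  ultimately show "bij_betw (Image ?Z) (carrier (homology k K)) (carrier (homology k L))"
    using carrier by (intro bij_betw_byWitness[where f' = "Image (?Z\<inverse>)"]) auto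
qed

lemma persistence_isomorphic_dowker:
  fixes R :: "real \<Rightarrow> 'a \<Rightarrow> 'b \<Rightarrow> bool"
  assumes fin: "finite X" "finite Y"
    and mono: "\<And>s t x y. s \<le> t \<Longrightarrow> R s x y \<Longrightarrow> R t x y"
  shows "persistence_isomorphic
    (persistent_homology k (\<lambda>t. dowker_complex X Y (R t)) :: ('k::field, _) persistence)
    (persistent_homology k (\<lambda>t. dowker_complex Y X (\<lambda>y x. R t x y)))"
proof -
  let ?K = "\<lambda>t. dowker_complex X Y (R t)" and ?L = "\<lambda>t. dowker_complex Y X (\<lambda>y x. R t x y)"
  let ?\<phi> = "\<lambda>t C. dowker_corr X Y (R t) k `` C"
  have "?\<phi> t (homology_inclusion k (?K t) C) = homology_inclusion k (?L t) (?\<phi> s C)"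
    if st: "s \<le> t" and C: "C \<in> carrier (homology k (?K s) :: ('k, _) module)" for s t C
  proof -
    from homology_dowker_cases[OF fin C] obtain z w where zw: "(z, w) \<in> dowker_corr X Y (R s) k"
      and C: "C = boundaries k (?K s) +>\<^bsub>cycle_space k (?K s)\<^esub> z" .
    \<comment> \<open>The same pair still corresponds at the later parameter, and inclusions keep
      representatives, so both ways around the square give the class of \<open>w\<close>.\<close>
    have zw': "(z, w) \<in> dowker_corr X Y (R t) k" using zw dowker_corr_mono[of "R s" "R t"] mono[OF st] by blast
    have "?K s \<subseteq> ?K t" "?L s \<subseteq> ?L t"
      by (rule dowker_complex_mono, rule mono[OF st], assumption)+
    with fin show ?thesis
      by (simp add: C homology_inclusion_class simplicial_complex_dowker_complex
          dowker_corr_class[OF fin zw] dowker_corr_class[OF fin zw'])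
  qed
  then show ?thesis unfolding persistence_isomorphic_def
    by (intro exI[of _ ?\<phi>]) (simp add: persistent_homology_def dowker_duality[OF fin])
qed

theorem corollary20:
  fixes X :: "'a set" and \<omega> :: "'a \<Rightarrow> 'a \<Rightarrow> real" and k :: nat
  assumes "finite X" and "X \<noteq> {}"
  shows "Dgm_sink TYPE('k::field) k X \<omega> = Dgm_source TYPE('k) k X \<omega>"
proof -
  \<comment> \<open>In the source complex the simplex sits in the second argument of
    \<open>\<omega>\<close>, so it belongs to the transpose of the sink relation.\<close>
  have "dowker_sink X \<omega> = (\<lambda>\<delta>. dowker_complex X X (\<lambda>x x'. \<omega> x x' \<le> \<delta>))"
    "dowker_source X \<omega> = (\<lambda>\<delta>. dowker_complex X X (\<lambda>x' x. \<omega> x x' \<le> \<delta>))"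
    by (auto simp: dowker_sink_def dowker_source_def dowker_complex_def fun_eq_iff)
  then have "persistence_isomorphic
      (persistent_homology k (dowker_sink X \<omega>) :: ('k, ('a set \<Rightarrow> 'k) set) persistence)
      (persistent_homology k (dowker_source X \<omega>))"
    using persistence_isomorphic_dowker[OF assms(1) assms(1), of "\<lambda>\<delta> x x'. \<omega> x x' \<le> \<delta>" k] by simp
  then show ?thesis unfolding Dgm_sink_def Dgm_source_def
    by (rule persistence_diagram_cong[OF persistence_vector_space_dowker(1)[OF assms(1)]])
qed

end
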